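(* Consider the randomly switched system $\dot x = f_\sigma(x)$, $(x(0),\sigma(0))=(x_0,\sigma_0)$, $t\ge 0$. Suppose that: (U1) there exist continuously differentiable functions $V_i:\mathbb{R}^n\to\mathbb{R}$, $i\in\mathcal P$, functions $\alpha_1,\alpha_2\in\mathcal K_\infty$, and numbers $\mu>1$ and $\lambda_i\in\mathbb{R}$, $i\in\mathcal P$, such that for all $x\in\mathbb{R}^n$ and $i,j\in\mathcal P$: $\alpha_1(\|x\|)\le V_i(x)\le\alpha_2(\|x\|)$; $\langle\nabla V_i(x), f_i(x)\rangle\le -\lambda_i V_i(x)$; $V_i(x)\le\mu V_j(x)$; (U2) the switching signal $\sigma$ belongs to class UH with parameters $T>0$ and $q_i\in[0,1]$, $i\in\mathcal P$; (U3) $\displaystyle\sum_{i\in\mathcal P}\frac{\mu q_i\left(1-e^{-\lambda_i T}\right)}{\lambda_i T}<1$. Then the system is $\alpha_1$-globally asymptotically stable in the mean.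
   Context: Notation: $\mathbb{N}=\{1,2,\dots\}$, $\mathbb{N}_0=\mathbb{N}\cup\{0\}$, $\|\cdot\|$ is the Euclidean norm, $\mathsf E$ is expectation. A function $\alpha:[0,\infty[\to[0,\infty[$ is of class $\mathcal K$ if it is continuous, strictly increasing and $\alpha(0)=0$; it is of class $\mathcal K_\infty$ if in addition it is unbounded. The ratio $(1-e^{-\lambda_iT})/(\lambda_iT)$ is understood as $1$ when $\lambda_i=0$. Setting: $\mathcal P=\{1,\dots,\mathrm N\}$ is a finite index set; for each $i\in\mathcal P$ the vector field $f_i:\mathbb{R}^n\to\mathbb{R}^n$ is locally Lipschitz with $f_i(0)=0$. On a complete probability space $(\Omega,\mathfrak F,\mathsf P)$, the switching signal $\sigma=(\sigma(t))_{t\ge0}$ is a càdlàg $\mathcal P$-valued process with $\sigma(0)=\sigma_0$ deterministic. Its switching instants are $0=\tau_0<\tau_1<\tau_2<\cdots$ (almost surely); $\sigma$ is constant on each $[\tau_i,\tau_{i+1}[$, and $\sigma(\tau_i)=\sigma(\tau_{i-1})$ is allowed. The holding times are $S_i:=\tau_i-\tau_{i-1}$, $i\in\mathbb{N}$. The state $x$ does not jump at switching instants, and $x(\cdot)$ denotes the (pathwise, Carathéodory, absolutely continuous) solution of the switched system for the initial state $x_0$. Class UH: $\sigma$ belongs to class UH if (UH1) $(S_i)_{i\in\mathbb{N}}$ is i.i.d., each $S_i$ uniformly distributed on $[0,T]$, $T>0$; (UH2) there exist $q_i\in[0,1]$, $i\in\mathcal P$, such that for all $j\in\mathbb{N}$,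 $\mathsf P\big(\sigma(\tau_j)=i\,\big|\,(\sigma(\tau_k))_{k=0}^{j-1}\big)=q_i$; (UH3) the sequences $(S_i)_{i\in\mathbb{N}}$ and $(\sigma(\tau_i))_{i\in\mathbb{N}_0}$ are mutually independent. For $\alpha\in\mathcal K$, $\alpha$-global asymptotic stability in the mean means: (SM1) for every $\varepsilon>0$ there is $\widetilde\delta>0$ such that for every $x_0$, $\|x_0\|<\widetilde\delta$ implies $\sup_{t\ge0}\mathsf E[\alpha(\|x(t)\|)]<\varepsilon$; and (SM2) for all $r,\varepsilon'>0$ there is $\widetilde T\ge0$ such that for every $x_0$, $\|x_0\|<r$ implies $\sup_{t\ge\widetilde T}\mathsf E[\alpha(\|x(t)\|)]<\varepsilon'$. *)

theory Defs
  imports "HOL-Probability.Probability"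
begin

subsection \<open>Comparison functions\<close>

text \<open>Only the values on \<open>[0, \<infinity>[\<close> matter; they are automatically nonnegative.\<close>

definition class_K :: "(real \<Rightarrow> real) \<Rightarrow> bool" where
  "class_K \<alpha> \<longleftrightarrow> continuous_on {0..} \<alpha> \<and> strict_mono_on {0..} \<alpha> \<and> \<alpha> 0 = 0"

definition class_K_inf :: "(real \<Rightarrow> real) \<Rightarrow> bool" where
  "class_K_inf \<alpha> \<longleftrightarrow> class_K \<alpha> \<and> \<not> bounded (\<alpha> ` {0..})"

text \<open>The ratio \<open>(1 - exp (- c)) / c\<close>, with its limiting value at \<open>c = 0\<close>.\<close>

definition exp_ratio :: "real \<Rightarrow> real" where
  "exp_ratio c = (if c = 0 then 1 else (1 - exp (- c)) / c)"


subsection \<open>Switching signals\<close>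

text \<open>The mode set carries the discrete topology, so one-sided limits are eventual equalities.\<close>

definition cadlag_discrete :: "(real \<Rightarrow> 'p) \<Rightarrow> bool" where
  "cadlag_discrete s \<longleftrightarrow>
     (\<forall>t\<ge>0. eventually (\<lambda>r. s r = s t) (at_right t)) \<and>
     (\<forall>t>0. \<exists>p. eventually (\<lambda>r. s r = p) (at_left t))"

text \<open>
  A switching signal comes with its sequence \<open>\<tau>\<close> of switching instants. The instants cannot be
  recovered from the paths of \<open>\<sigma>\<close>, since the value of \<open>\<sigma>\<close> need not change at a switching instant.
  Values at negative times are irrelevant.
\<close>

definition switching_signal ::
  "'w measure \<Rightarrow> 'p \<Rightarrow> (real \<Rightarrow> 'w \<Rightarrow> 'p) \<Rightarrow> (nat \<Rightarrow> 'w \<Rightarrow> real) \<Rightarrow> bool" where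
  "switching_signal M \<sigma>0 \<sigma> \<tau> \<longleftrightarrow>
     (\<forall>t\<ge>0. \<sigma> t \<in> measurable M (count_space UNIV)) \<and>
     (\<forall>i. \<tau> i \<in> borel_measurable M) \<and>
     (AE \<omega> in M.
        \<sigma> 0 \<omega> = \<sigma>0 \<and>
        cadlag_discrete (\<lambda>t. \<sigma> t \<omega>) \<and>
        \<tau> 0 \<omega> = 0 \<and>
        (\<forall>i. \<tau> i \<omega> < \<tau> (Suc i) \<omega>) \<and>
        (\<forall>i. \<forall>t\<in>{\<tau> i \<omega>..<\<tau> (Suc i) \<omega>}. \<sigma> t \<omega> = \<sigma> (\<tau> i \<omega>) \<omega>))"

text \<open>Only meaningful for \<open>i \<ge> 1\<close>.\<close>

definition holding_time :: "(nat \<Rightarrow> 'w \<Rightarrow> real) \<Rightarrow> nat \<Rightarrow> 'w \<Rightarrow> real" where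
  "holding_time \<tau> i \<omega> = \<tau> i \<omega> - \<tau> (i - 1) \<omega>"

definition mode_at :: "(real \<Rightarrow> 'w \<Rightarrow> 'p) \<Rightarrow> (nat \<Rightarrow> 'w \<Rightarrow> real) \<Rightarrow> nat \<Rightarrow> 'w \<Rightarrow> 'p" where
  "mode_at \<sigma> \<tau> j \<omega> = \<sigma> (\<tau> j \<omega>) \<omega>"

text \<open>
  The conditional probability given the past modes is the
  conditional expectation of the indicator of the event with respect to the sigma-algebra they
  generate; independence of the two sequences is independence of the sigma-algebras they generate.
\<close>

definition class_UH ::
  "'w measure \<Rightarrow> (real \<Rightarrow> 'w \<Rightarrow> 'p) \<Rightarrow> (nat \<Rightarrow> 'w \<Rightarrow> real) \<Rightarrow> real \<Rightarrow> ('p \<Rightarrow> real) \<Rightarrow> bool" where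
  "class_UH M \<sigma> \<tau> T q \<longleftrightarrow>
     (T > 0 \<and>
      prob_space.indep_vars M (\<lambda>_. borel) (holding_time \<tau>) {1..} \<and>
      (\<forall>i\<ge>1. distr M borel (holding_time \<tau> i) = uniform_measure lborel {0..T})) \<and>
     ((\<forall>i. q i \<in> {0..1}) \<and>
      (\<forall>j\<ge>1. \<forall>i. AE \<omega> in M.
         real_cond_exp M
           (vimage_algebra (space M) (\<lambda>\<omega>. \<lambda>k\<in>{..<j}. mode_at \<sigma> \<tau> k \<omega>)
              (PiM {..<j} (\<lambda>_. count_space UNIV)))
           (indicator {\<omega> \<in> space M. mode_at \<sigma> \<tau> j \<omega> = i}) \<omega> = q i)) \<and>
     prob_space.indep_set M
       (sets (vimage_algebra (space M) (\<lambda>\<omega>. \<lambda>i\<in>{1..}. holding_time \<tau> i \<omega>)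
                (PiM {1..} (\<lambda>_. borel))))
       (sets (vimage_algebra (space M) (\<lambda>\<omega> i. mode_at \<sigma> \<tau> i \<omega>)
                (PiM UNIV (\<lambda>_. count_space UNIV))))"


subsection \<open>Solutions\<close>

text \<open>
  The usual epsilon-delta notion on a compact interval. A \<open>division_of\<close> family is a finite family of
  nonempty compact intervals with disjoint interiors, which need not cover \<open>{a..b}\<close> here;
  \<open>Inf K\<close> and \<open>Sup K\<close> are the end points of \<open>K\<close>.
\<close>

definition abs_continuous_on :: "real \<Rightarrow> real \<Rightarrow> (real \<Rightarrow> 'a::real_normed_vector) \<Rightarrow> bool" where
  "abs_continuous_on a b y \<longleftrightarrow>
     (\<forall>\<epsilon>>0. \<exists>\<delta>>0. \<forall>D. D division_of \<Union>D \<and> \<Union>D \<subseteq> {a..b} \<and> (\<Sum>K\<in>D. Sup K - Inf K) < \<delta> \<longrightarrow>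
        (\<Sum>K\<in>D. norm (y (Sup K) - y (Inf K))) < \<epsilon>)"

text \<open>Caratheodory solution on \<open>[0, \<infinity>[\<close> of \<open>y' = f\<^bsub>s(t)\<^esub>(y)\<close>, \<open>y(0) = x0\<close>.\<close>

definition caratheodory_solution ::
  "('p \<Rightarrow> 'a::real_normed_vector \<Rightarrow> 'a) \<Rightarrow> (real \<Rightarrow> 'p) \<Rightarrow> 'a \<Rightarrow> (real \<Rightarrow> 'a) \<Rightarrow> bool" where
  "caratheodory_solution f s x0 y \<longleftrightarrow>
     y 0 = x0 \<and>
     (\<forall>t\<ge>0. abs_continuous_on 0 t y) \<and>
     (AE t in lborel. t > 0 \<longrightarrow> (y has_vector_derivative f (s t) (y t)) (at t))"

text \<open>
  \<open>x x0 t \<omega>\<close> is the state at time \<open>t\<close> of the switched system started at \<open>x0\<close>. Null sets may depend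
  on the initial state.
\<close>

definition state_process ::
  "'w measure \<Rightarrow> ('p \<Rightarrow> 'a::real_normed_vector \<Rightarrow> 'a) \<Rightarrow> (real \<Rightarrow> 'w \<Rightarrow> 'p)
     \<Rightarrow> ('a \<Rightarrow> real \<Rightarrow> 'w \<Rightarrow> 'a) \<Rightarrow> bool" where
  "state_process M f \<sigma> x \<longleftrightarrow>
     (\<forall>x0. AE \<omega> in M. caratheodory_solution f (\<lambda>t. \<sigma> t \<omega>) x0 (\<lambda>t. x x0 t \<omega>))"


subsection \<open>Stability in the mean\<close>

text \<open>
  The expectation of the nonnegative quantity \<open>\<alpha> (norm (x x0 t \<omega>))\<close> is its integral in
  \<open>[0, \<infinity>]\<close>, so non-integrability shows up as the value \<open>\<infinity>\<close>. Measurability of the state is not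
  assumed: for locally Lipschitz vector fields on a complete probability space the solution is
  almost surely unique and hence measurable.
\<close>

definition gas_in_mean ::
  "'w measure \<Rightarrow> (real \<Rightarrow> real) \<Rightarrow> ('a::real_normed_vector \<Rightarrow> real \<Rightarrow> 'w \<Rightarrow> 'a) \<Rightarrow> bool" where
  "gas_in_mean M \<alpha> x \<longleftrightarrow>
     (\<forall>\<epsilon>>0::real. \<exists>\<delta>>0. \<forall>x0. norm x0 < \<delta> \<longrightarrow>
        (SUP t\<in>{0..}. \<integral>\<^sup>+ \<omega>. ennreal (\<alpha> (norm (x x0 t \<omega>))) \<partial>M) < ennreal \<epsilon>) \<and>
     (\<forall>r>0. \<forall>\<epsilon>>0::real. \<exists>T\<ge>0. \<forall>x0. norm x0 < r \<longrightarrow>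
        (SUP t\<in>{T..}. \<integral>\<^sup>+ \<omega>. ennreal (\<alpha> (norm (x x0 t \<omega>))) \<partial>M) < ennreal \<epsilon>)"

end

theory Submission
  imports Defs
begin

text \<open>
  Along a path, \<open>V\<close> decays like \<open>exp (- \<lambda>\<^sub>i t)\<close> between switches and grows by at most \<open>\<mu>\<close> at a switch,
  so at a time \<open>t\<close> between the switches \<open>N\<close> and \<open>N + 1\<close> the value \<open>\<alpha>\<^sub>1 (norm (x t))\<close> is at most
  \<open>K * \<alpha>\<^sub>2 (norm x0)\<close> times a product \<open>F N\<close> of \<open>N\<close> factors \<open>\<mu> * exp (- \<lambda> S)\<close>. By independence the
  expectation of \<open>F N\<close> is of order \<open>\<rho> ^ N\<close>, where \<open>\<rho> < 1\<close> is the sum in (U3). The holding times are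
  at most \<open>T\<close>, so \<open>N \<ge> n\<close> as soon as \<open>t \<ge> n * T\<close>, and the unknown \<open>N\<close> is dealt with by summing \<open>F N\<close>
  over all \<open>N \<ge> n\<close>: the expectation of \<open>\<alpha>\<^sub>1 (norm (x t))\<close> is bounded by the tail of a geometric series.
\<close>

subsection \<open>Absolutely continuous functions\<close>

lemma abs_continuous_on_subset:
  "abs_continuous_on a b y \<Longrightarrow> {c..d} \<subseteq> {a..b} \<Longrightarrow> abs_continuous_on c d y"
  unfolding abs_continuous_on_def by (meson order_trans)

lemma abs_continuous_onE:
  assumes "abs_continuous_on a b y" "\<epsilon> > 0"
  obtains \<delta> where "\<delta> > 0" "\<And>D. \<lbrakk>D division_of \<Union>D; \<Union>D \<subseteq> {a..b}; (\<Sum>K\<in>D. Sup K - Inf K) < \<delta>\<rbrakk>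
      \<Longrightarrow> (\<Sum>K\<in>D. norm (y (Sup K) - y (Inf K))) < \<epsilon>"
proof -
  have "\<exists>\<delta>>0. \<forall>D. D division_of \<Union>D \<and> \<Union>D \<subseteq> {a..b} \<and> (\<Sum>K\<in>D. Sup K - Inf K) < \<delta> \<longrightarrow>
        (\<Sum>K\<in>D. norm (y (Sup K) - y (Inf K))) < \<epsilon>"
    using assms(1)[unfolded abs_continuous_on_def, THEN spec, THEN mp, OF assms(2)] .
  then obtain \<delta> where "\<delta> > 0" and \<delta>: "\<forall>D. D division_of \<Union>D \<and> \<Union>D \<subseteq> {a..b} \<and> (\<Sum>K\<in>D. Sup K - Inf K) < \<delta> \<longrightarrow>
        (\<Sum>K\<in>D. norm (y (Sup K) - y (Inf K))) < \<epsilon>"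
    by (elim exE conjE)
  then show ?thesis by (intro that[OF \<open>\<delta> > 0\<close> \<delta>[THEN spec, THEN mp]] conjI)
qed

text \<open>A single interval \<open>{u..v}\<close> is already a division, so the definition
  specialises to uniform continuity.\<close>

lemma abs_continuous_on_imp_continuous_on:
  assumes "abs_continuous_on a b y"
  shows "continuous_on {a..b} y"
  unfolding continuous_on_iff
proof (intro ballI allI impI)
  fix s e :: real
  assume s: "s \<in> {a..b}" and e: "e > 0"
  obtain d where d: "d > 0" and ac: "\<And>D. \<lbrakk>D division_of \<Union>D; \<Union>D \<subseteq> {a..b}; (\<Sum>K\<in>D. Sup K - Inf K) < d\<rbrakk>
      \<Longrightarrow> (\<Sum>K\<in>D. norm (y (Sup K) - y (Inf K))) < e"
    by (rule abs_continuous_onE[OF assms e]) blast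
  have small: "norm (y v - y u) < e" if "u \<in> {a..b}" "v \<in> {a..b}" "u \<le> v" "v - u < d" for u v
  proof -
    have "{{u..v}} division_of {u..v}"
      using that by (metis box_real(2) division_of_self atLeastAtMost_iff order_refl empty_iff)
    then show ?thesis
      using ac[of "{{u..v}}"] that by auto
  qed
  show "\<exists>d>0. \<forall>t\<in>{a..b}. dist t s < d \<longrightarrow> dist (y t) (y s) < e"
  proof (intro exI conjI ballI impI)
    fix t assume "t \<in> {a..b}" "dist t s < d"
    then show "dist (y t) (y s) < e"
      using small[of t s] small[of s t] s
      by (cases "t \<le> s") (auto simp: dist_norm norm_minus_commute)
  qed (rule d)
qed

text \<open>The increments of \<open>h\<close> over a division are dominated by those of the
  identity and of \<open>y\<close>, which are both small once the total length is small. This serves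
  for the product of an exponential with a Lyapunov function along a path.\<close>

lemma abs_continuous_on_Lipschitz_image:
  fixes y :: "real \<Rightarrow> 'a::real_normed_vector" and h :: "real \<Rightarrow> 'b::real_normed_vector"
  assumes ac: "abs_continuous_on a b y" and L: "L \<ge> 0"
    and h: "\<And>u v. \<lbrakk>u \<in> {a..b}; v \<in> {a..b}; u \<le> v\<rbrakk> \<Longrightarrow> norm (h v - h u) \<le> L * ((v - u) + norm (y v - y u))"
  shows "abs_continuous_on a b h"
  unfolding abs_continuous_on_def
proof (intro allI impI)
  fix e :: real assume e: "e > 0"
  \<comment> \<open>The bound reached is \<open>L * (e' + e') = e - 2 * e'\<close>, strictly below
    \<open>e\<close>; the \<open>+ 1\<close> keeps the denominator positive for
    \<open>L = 0\<close>.\<close>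
  define e' where "e' = e / (2 * (L + 1))"
  have e': "e' > 0" using e L by (auto simp: e'_def)
  have e2: "2 * (L + 1) * e' = e" using L by (simp add: e'_def)
  obtain d where d: "d > 0" and acd: "\<And>D. \<lbrakk>D division_of \<Union>D; \<Union>D \<subseteq> {a..b}; (\<Sum>K\<in>D. Sup K - Inf K) < d\<rbrakk>
      \<Longrightarrow> (\<Sum>K\<in>D. norm (y (Sup K) - y (Inf K))) < e'"
    by (rule abs_continuous_onE[OF ac e']) blast
  show "\<exists>d>0. \<forall>D. D division_of \<Union>D \<and> \<Union>D \<subseteq> {a..b} \<and> (\<Sum>K\<in>D. Sup K - Inf K) < d \<longrightarrow>
      (\<Sum>K\<in>D. norm (h (Sup K) - h (Inf K))) < e"
  proof (intro exI conjI allI impI; (elim conjE)?)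
    show "min d e' > 0" using d e' by simp
    fix D assume D: "D division_of \<Union>D" "\<Union>D \<subseteq> {a..b}" "(\<Sum>K\<in>D. Sup K - Inf K) < min d e'"
    have "(\<Sum>K\<in>D. norm (h (Sup K) - h (Inf K))) \<le> (\<Sum>K\<in>D. L * ((Sup K - Inf K) + norm (y (Sup K) - y (Inf K))))"
    proof (rule sum_mono)
      fix K assume K: "K \<in> D"
      then obtain u v where uv: "K = {u..v}" "u \<le> v"
        using division_ofD(3,4)[OF D(1) K] by (metis atLeastatMost_empty_iff box_real(2))
      then have "u \<in> {a..b}" "v \<in> {a..b}" using D(2) K by force+
      then show "norm (h (Sup K) - h (Inf K)) \<le> L * ((Sup K - Inf K) + norm (y (Sup K) - y (Inf K)))"
        using h uv by simp
    qed
    also have "\<dots> = L * ((\<Sum>K\<in>D. Sup K - Inf K) + (\<Sum>K\<in>D. norm (y (Sup K) - y (Inf K))))"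
      by (simp flip: sum_distrib_left sum.distrib)
    also have "\<dots> \<le> L * (e' + e')"
      using acd[OF D(1,2)] D(3) L by (intro mult_left_mono add_mono) auto
    also have "\<dots> = e - 2 * e'" using e2 by (simp add: algebra_simps)
    also have "\<dots> < e" using e' by simp
    finally show "(\<Sum>K\<in>D. norm (h (Sup K) - h (Inf K))) < e" .
  qed
qed

text \<open>Members of a division meet only in negligible sets, so their lengths add up to the
  measure of the union. This converts an open set of small measure into the length condition of
  absolute continuity.\<close>

lemma sum_length_division_le_measure:
  fixes D :: "real set set"
  assumes D: "D division_of \<Union>D" and U: "\<Union>D \<subseteq> U" "U \<in> lmeasurable"
  shows "(\<Sum>K\<in>D. Sup K - Inf K) \<le> measure lebesgue U"
proof -
  note D' = division_ofD[OF D]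
  have iv: "\<exists>u v. K = {u..v} \<and> u \<le> v" if "K \<in> D" for K
    using D'(3,4)[OF that] by (metis atLeastatMost_empty_iff box_real(2))
  have "(\<Sum>K\<in>D. Sup K - Inf K) = (\<Sum>K\<in>D. measure lebesgue K)"
    using iv by (intro sum.cong refl) fastforce
  also have "\<dots> = measure lebesgue (\<Union>D)"
  proof (rule measure_negligible_finite_Union[symmetric])
    show "pairwise (\<lambda>S T. negligible (S \<inter> T)) D"
    proof (intro pairwiseI)
      fix S T assume ST: "S \<in> D" "T \<in> D" "S \<noteq> T"
      obtain u v u' v' where e: "S = {u..v}" "T = {u'..v'}" using iv ST by meson
      have "interior (S \<inter> T) = {}" using D'(5)[OF ST] by simp
      moreover have "S \<inter> T = cbox (max u u') (min v v')" using e by auto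
      ultimately show "negligible (S \<inter> T)" by (metis interior_cbox negligible_interval(1))
    qed
  qed (use D'(1) iv in force)+
  also have "\<dots> \<le> measure lebesgue U"
    using iv D'(1) by (intro measure_mono_fmeasurable U sets.finite_Union) force+
  finally show ?thesis .
qed

text \<open>
  By Cousin's lemma, \<open>{a..b}\<close> has a fine tagged division whose tags with a good derivative
  contribute at most \<open>\<epsilon> * (b - a)\<close>, while the remaining intervals lie in an open set of small measure,
  where absolute continuity applies.
\<close>

lemma abs_continuous_on_AE_deriv_nonpos_imp_le:
  fixes h :: "real \<Rightarrow> real"
  assumes ac: "abs_continuous_on a b h" and ab: "a \<le> b"
    and deriv: "AE t in lborel. a < t \<and> t < b \<longrightarrow> (\<exists>D\<le>0. (h has_real_derivative D) (at t))"
  shows "h b \<le> h a"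
proof (rule field_le_epsilon)
  fix \<eta> :: real assume \<eta>: "\<eta> > 0"
  \<comment> \<open>The exceptional intervals will contribute at most \<open>e\<close> and the
    others at most \<open>e * (b - a)\<close>, together \<open>\<eta>\<close>.\<close>
  define e where "e = \<eta> / (b - a + 1)"
  have e: "e > 0" using \<eta> ab by (simp add: e_def)
  obtain d where d: "d > 0" and acd: "\<And>D. \<lbrakk>D division_of \<Union>D; \<Union>D \<subseteq> {a..b}; (\<Sum>K\<in>D. Sup K - Inf K) < d\<rbrakk>
      \<Longrightarrow> (\<Sum>K\<in>D. norm (h (Sup K) - h (Inf K))) < e"
    by (rule abs_continuous_onE[OF ac e]) blast
  define good where "good t \<longleftrightarrow> (\<exists>D\<le>0. (h has_real_derivative D) (at t))" for t
  \<comment> \<open>Nothing is assumed about the derivative at the end points; as a null set they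
    can be absorbed into the exceptional set \<open>Z\<close>.\<close>
  have "AE t in lborel. t \<noteq> a \<and> t \<noteq> b" using AE_lborel_singleton[of a] AE_lborel_singleton[of b] by auto
  with deriv have "AE t in lborel. t \<in> {a..b} \<longrightarrow> good t"
    by eventually_elim (auto simp: good_def)
  then obtain Z where Z: "Z \<in> null_sets lborel" "{t. \<not> (t \<in> {a..b} \<longrightarrow> good t)} \<subseteq> Z"
    by (auto elim!: AE_E simp: null_sets_def)
  have Z0: "Z \<in> sets lebesgue" "emeasure lebesgue Z = 0"
    using Z(1) by (auto simp: null_sets_def sets_completionI_sets)
  obtain U where U: "open U" "Z \<subseteq> U" "U - Z \<in> lmeasurable" "emeasure lebesgue (U - Z) < ennreal d"
    using sets_lebesgue_outer_open[OF Z0(1) d] by metis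
  have U_sets: "U \<in> sets lebesgue" using U(1) by simp
  have "emeasure lebesgue U \<le> emeasure lebesgue (U - Z) + emeasure lebesgue Z"
    using U U_sets Z0 by (metis Diff_partition Un_commute emeasure_subadditive fmeasurableD)
  then have emU: "emeasure lebesgue U < ennreal d" using U(4) Z0 by simp
  then have Um: "U \<in> lmeasurable"
    using U_sets by (intro fmeasurableI) (auto intro: order.strict_trans)
  then have mU: "measure lebesgue U < d"
    using emU by (simp add: emeasure_eq_measure2 ennreal_less_iff)
  \<comment> \<open>This radius becomes the gauge. Around a point of \<open>Z\<close> the ball stays
    in \<open>U\<close>; at the other points of \<open>{a..b}\<close>, \<open>D \<le> 0\<close> lets
    \<open>h\<close> rise with slope at most \<open>e\<close> on either side of
    \<open>t\<close>.\<close>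
  have "\<exists>r>0. (if t \<in> Z then ball t r \<subseteq> U else t \<in> {a..b} \<longrightarrow> 
     (\<forall>s. \<bar>s - t\<bar> < r \<longrightarrow> (t \<le> s \<longrightarrow> h s - h t \<le> e * (s - t)) \<and> (s \<le> t \<longrightarrow> h t - h s \<le> e * (t - s))))" for t
  proof (cases "t \<in> Z")
    case True
    then show ?thesis using U(1,2) by (auto simp: open_contains_ball)
  next
    case False
    show ?thesis
    proof (cases "t \<in> {a..b}")
      case True
      then have "good t" using False Z(2) by blast
      then obtain D where D: "D \<le> 0" "(h has_derivative (*) D) (at t)"
        by (auto simp: good_def has_field_derivative_def)
      then obtain r where r: "r > 0" "\<And>s. \<bar>s - t\<bar> < r \<Longrightarrow> \<bar>h s - h t - D * (s - t)\<bar> \<le> e * \<bar>s - t\<bar>"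
        using e unfolding has_derivative_at_alt by (auto simp: real_norm_def)
      show ?thesis
      proof (intro exI[of _ r] conjI r(1))
        have "(t \<le> s \<longrightarrow> h s - h t \<le> e * (s - t)) \<and> (s \<le> t \<longrightarrow> h t - h s \<le> e * (t - s))" if "\<bar>s - t\<bar> < r" for s
        proof -
          have "t \<le> s \<Longrightarrow> D * (s - t) \<le> 0" "s \<le> t \<Longrightarrow> D * (s - t) \<ge> 0"
            using D(1) by (auto simp: mult_le_0_iff zero_le_mult_iff)
          with r(2)[OF that] show ?thesis by (auto simp: abs_if split: if_splits)
        qed
        then show "if t \<in> Z then ball t r \<subseteq> U else t \<in> {a..b} \<longrightarrow> 
          (\<forall>s. \<bar>s - t\<bar> < r \<longrightarrow> (t \<le> s \<longrightarrow> h s - h t \<le> e * (s - t)) \<and> (s \<le> t \<longrightarrow> h t - h s \<le> e * (t - s)))"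
          using False by simp
      qed
    qed (use False in \<open>auto intro: zero_less_one\<close>)
  qed
  then obtain r where r: "\<And>t. r t > 0"
    and rZ: "\<And>t. t \<in> Z \<Longrightarrow> ball t (r t) \<subseteq> U"
    and rN: "\<And>t s. \<lbrakk>t \<notin> Z; t \<in> {a..b}; \<bar>s - t\<bar> < r t\<rbrakk> \<Longrightarrow>
       (t \<le> s \<longrightarrow> h s - h t \<le> e * (s - t)) \<and> (s \<le> t \<longrightarrow> h t - h s \<le> e * (t - s))"
    by (metis (no_types, lifting))
  have "gauge (\<lambda>t. ball t (r t))" using r by (simp add: gauge_def)
  then obtain p0 where p0: "p0 tagged_division_of {a..b}" "(\<lambda>t. ball t (r t)) fine p0"
    by (rule fine_division_exists_real)
  define D where "D = snd ` p0"
  have D: "D division_of {a..b}" unfolding D_def by (rule division_of_tagged_division[OF p0(1)])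
  note D' = division_ofD[OF D]
  \<comment> \<open>Choosing one tag per interval lets sums over tagged pairs be rewritten as sums
    over the intervals of \<open>D\<close>.\<close>
  define tag where "tag K = (SOME t. (t, K) \<in> p0)" for K
  have tag: "(tag K, K) \<in> p0" if "K \<in> D" for K
    using that by (auto simp: D_def tag_def intro: someI)
  define p where "p = (\<lambda>K. (tag K, K)) ` D"
  have inj: "inj_on (\<lambda>K. (tag K, K)) D" by (auto simp: inj_on_def)
  note p0' = tagged_division_ofD[OF p0(1)]
  have p: "p tagged_division_of {a..b}"
  proof (rule tagged_division_ofI)
    show "finite p" using D'(1) by (simp add: p_def)
    have "{K. \<exists>x. (x, K) \<in> p} = D" by (auto simp: p_def)
    then show "\<Union>{K. \<exists>x. (x, K) \<in> p} = {a..b}" using D'(6) by simp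
    fix x K assume xK: "(x, K) \<in> p"
    then have "(x, K) \<in> p0" using tag by (auto simp: p_def)
    then show "x \<in> K" "K \<subseteq> {a..b}" "\<exists>a b. K = cbox a b" using p0'(2-4) by blast+
    fix x' K' assume "(x', K') \<in> p" "(x, K) \<noteq> (x', K')"
    then show "interior K \<inter> interior K' = {}" using xK D'(5) by (auto simp: p_def)
  qed
  have iv: "\<exists>u v. K = {u..v} \<and> u \<le> tag K \<and> tag K \<le> v \<and> a \<le> u \<and> v \<le> b \<and> K \<subseteq> ball (tag K) (r (tag K))"
    if K: "K \<in> D" for K
  proof -
    have "K \<subseteq> ball (tag K) (r (tag K))" using p0(2) tag[OF K] by (auto simp: fine_def)
    moreover obtain u v where "K = {u..v}" using D'(4)[OF K] by auto
    moreover have "tag K \<in> K" using p0'(2) tag[OF K] by blast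
    moreover have "K \<subseteq> {a..b}" using D'(2)[OF K] by blast
    ultimately show ?thesis by (metis atLeastAtMost_iff atLeastatMost_subset_iff order_trans)
  qed
  \<comment> \<open>Used for \<open>h\<close> itself and for the identity, which gives the total
    length \<open>b - a\<close>.\<close>
  have tele: "(\<Sum>K\<in>D. g (Sup K) - g (Inf K)) = g b - g a" for g :: "real \<Rightarrow> real"
    using additive_tagged_division_1[OF ab p, of g] inj by (simp add: p_def sum.reindex)
  define DZ where "DZ = {K \<in> D. tag K \<in> Z}"
  have DZ: "DZ division_of \<Union>DZ" "DZ \<subseteq> D"
    using division_of_subset[of D DZ] division_of_union_self[OF D] by (auto simp: DZ_def)
  have "\<Union>DZ \<subseteq> U" using iv rZ by (fastforce simp: DZ_def)
  then have len: "(\<Sum>K\<in>DZ. Sup K - Inf K) < d"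
    using sum_length_division_le_measure[OF DZ(1) _ Um] mU by linarith
  have "\<Union>DZ \<subseteq> {a..b}" using D'(2) DZ(2) by blast
  then have "(\<Sum>K\<in>DZ. norm (h (Sup K) - h (Inf K))) < e" using acd[OF DZ(1) _ len] by blast
  then have bZ: "(\<Sum>K\<in>DZ. h (Sup K) - h (Inf K)) \<le> e"
    by (intro order_trans[OF sum_mono less_imp_le]) auto
  have len0: "Sup K - Inf K \<ge> 0" if "K \<in> D" for K using iv[OF that] by auto
  have "(\<Sum>K\<in>D - DZ. h (Sup K) - h (Inf K)) \<le> (\<Sum>K\<in>D - DZ. e * (Sup K - Inf K))"
  proof (rule sum_mono)
    fix K assume K: "K \<in> D - DZ"
    then have nZ: "tag K \<notin> Z" by (auto simp: DZ_def)
    obtain u v where uv: "K = {u..v}" "u \<le> tag K" "tag K \<le> v" "a \<le> u" "v \<le> b" "K \<subseteq> ball (tag K) (r (tag K))"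
      using iv K by blast
    then have "u \<in> K" "v \<in> K" by (metis atLeastAtMost_iff order_refl order_trans)+
    then have "u \<in> ball (tag K) (r (tag K))" "v \<in> ball (tag K) (r (tag K))" using uv(6) by blast+
    \<comment> \<open>The tag lies between \<open>u\<close> and \<open>v\<close>, so the one-sided
      estimates at the tag add up to the estimate for the whole interval.\<close>
    then have "h v - h (tag K) \<le> e * (v - tag K)" "h (tag K) - h u \<le> e * (tag K - u)"
      using rN[OF nZ, of u] rN[OF nZ, of v] uv by (auto simp: dist_real_def abs_minus_commute)
    then have "h v - h u \<le> e * (v - u)" by (simp add: algebra_simps)
    then show "h (Sup K) - h (Inf K) \<le> e * (Sup K - Inf K)" using uv by simp
  qed
  also have "\<dots> \<le> (\<Sum>K\<in>D. e * (Sup K - Inf K))"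
    using len0 e D'(1) by (intro sum_mono2) auto
  also have "\<dots> = e * (b - a)" using tele[of "\<lambda>x. x"] by (simp flip: sum_distrib_left)
  finally have bN: "(\<Sum>K\<in>D - DZ. h (Sup K) - h (Inf K)) \<le> e * (b - a)" .
  have "h b - h a = (\<Sum>K\<in>D - DZ. h (Sup K) - h (Inf K)) + (\<Sum>K\<in>DZ. h (Sup K) - h (Inf K))"
    using tele[of h] sum.subset_diff[OF DZ(2) D'(1)] by metis
  also have "\<dots> \<le> e * (b - a + 1)" using bZ bN by (simp add: algebra_simps)
  also have "\<dots> = \<eta>" using ab by (simp add: e_def)
  finally show "h b \<le> h a + \<eta>" by simp
qed

section \<open>Lyapunov decay in a fixed mode\<close>

text \<open>The product \<open>exp (lam * (t - a)) * V (y t)\<close> is absolutely continuous, and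
  by \<open>decay\<close> its derivative is almost everywhere nonpositive, hence it does not
  increase. For \<open>lam < 0\<close> the result bounds the growth instead.\<close>

lemma Lyapunov_decay:
  fixes V :: "'a::euclidean_space \<Rightarrow> real" and y :: "real \<Rightarrow> 'a"
  assumes V: "\<And>z. GDERIV V z :> gradV z" "continuous_on UNIV gradV"
    and decay: "\<And>z. gradV z \<bullet> f z \<le> - lam * V z"
    and ab: "a \<le> b" and ac: "abs_continuous_on a b y"
    and sol: "AE t in lborel. a < t \<and> t < b \<longrightarrow> (y has_vector_derivative f (y t)) (at t)"
  shows "V (y b) \<le> exp (- lam * (b - a)) * V (y a)"
proof -
  define g where "g t = exp (lam * (t - a))" for t
  define h where "h t = g t * V (y t)" for t
  have Vd: "(V has_derivative (\<lambda>w. w \<bullet> gradV z)) (at z)" for z using V(1) by (simp add: gderiv_def)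
  have contV: "continuous_on S V" for S
    using Vd by (meson has_derivative_continuous continuous_at_imp_continuous_on)
  have conty: "continuous_on {a..b} y" by (rule abs_continuous_on_imp_continuous_on[OF ac])
  have "bounded (y ` {a..b})" by (intro compact_imp_bounded compact_continuous_image conty) simp
  \<comment> \<open>The range of \<open>y\<close> is enclosed in a ball because the mean value
    estimate \<open>LV\<close> requires a convex set.\<close>
  then obtain R where "\<forall>z\<in>y ` {a..b}. norm z \<le> R" unfolding bounded_iff by blast
  then have R: "y t \<in> cball 0 R" if "t \<in> {a..b}" for t using that by auto
  have "bounded (V ` cball 0 R)" "bounded (gradV ` cball 0 R)" "bounded (g ` {a..b})"
    by (auto simp: g_def intro!: compact_imp_bounded compact_continuous_image contV continuous_on_subset[OF V(2)] continuous_intros)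
  then obtain W B E where "\<forall>x\<in>V ` cball 0 R. norm x \<le> W" "\<forall>x\<in>gradV ` cball 0 R. norm x \<le> B"
    "\<forall>x\<in>g ` {a..b}. norm x \<le> E"
    unfolding bounded_iff by blast
  then have W: "\<And>z. z \<in> cball 0 R \<Longrightarrow> \<bar>V z\<bar> \<le> W" and B: "\<And>z. z \<in> cball 0 R \<Longrightarrow> norm (gradV z) \<le> B"
    and E: "\<And>t. t \<in> {a..b} \<Longrightarrow> \<bar>g t\<bar> \<le> E"
    by auto
  have a: "a \<in> {a..b}" using ab by simp
  have nn: "W \<ge> 0" "B \<ge> 0" "E \<ge> 0" 
    using W[OF R[OF a]] B[OF R[OF a]] E[OF a] abs_ge_zero norm_ge_zero order_trans by blast+
  have LV: "norm (V z - V w) \<le> B * norm (z - w)" if "z \<in> cball 0 R" "w \<in> cball 0 R" for z w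
  proof (rule differentiable_bound[OF convex_cball _ _ that])
    fix x :: 'a assume "x \<in> cball 0 R"
    then show "onorm (\<lambda>w. w \<bullet> gradV x) \<le> B"
      using Cauchy_Schwarz_ineq2[of _ "gradV x"] B[of x]
      by (intro onorm_le) (metis mult.commute mult_left_mono norm_ge_zero order_trans real_norm_def)
  qed (use Vd has_derivative_at_withinI in blast)
  have gd: "(g has_real_derivative lam * g t) (at t within S)" for t S
    unfolding g_def by (auto intro!: derivative_eq_intros)
  have Lg: "norm (g v - g u) \<le> (\<bar>lam\<bar> * E) * norm (v - u)" if "u \<in> {a..b}" "v \<in> {a..b}" for u v
    by (rule field_differentiable_bound[OF convex_real_interval(5) gd _ that(2,1)])
       (auto simp: abs_mult intro!: mult_left_mono E)
  \<comment> \<open>The summands bound the two parts of an increment of the product: the change of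
    \<open>g\<close> times the size of \<open>V\<close>, and the size of \<open>g\<close> times the
    change of \<open>V\<close>.\<close>
  define L where "L = \<bar>lam\<bar> * E * W + E * B"
  have "abs_continuous_on a b h"
  proof (rule abs_continuous_on_Lipschitz_image[OF ac])
    show "L \<ge> 0" using nn by (simp add: L_def)
    fix u v assume uv: "u \<in> {a..b}" "v \<in> {a..b}" "u \<le> v"
    have "h v - h u = g v * (V (y v) - V (y u)) + (g v - g u) * V (y u)" by (simp add: h_def algebra_simps)
    then have "norm (h v - h u) \<le> \<bar>g v\<bar> * norm (V (y v) - V (y u)) + norm (g v - g u) * \<bar>V (y u)\<bar>"
      using norm_triangle_ineq[of "g v * (V (y v) - V (y u))" "(g v - g u) * V (y u)"] by (simp add: abs_mult)
    also have "\<dots> \<le> E * (B * norm (y v - y u)) + (\<bar>lam\<bar> * E * norm (v - u)) * W"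
      by (intro add_mono mult_mono E LV Lg W R uv) (use nn in auto)
    also have "\<dots> = (E * B) * norm (y v - y u) + (\<bar>lam\<bar> * E * W) * (v - u)" using uv by simp
    also have "\<dots> \<le> L * norm (y v - y u) + L * (v - u)"
      using nn uv by (intro add_mono mult_right_mono) (auto simp: L_def)
    also have "\<dots> = L * ((v - u) + norm (y v - y u))" by (simp add: algebra_simps)
    finally show "norm (h v - h u) \<le> L * ((v - u) + norm (y v - y u))" .
  qed
  moreover have "AE t in lborel. a < t \<and> t < b \<longrightarrow> (\<exists>D\<le>0. (h has_real_derivative D) (at t))"
    using sol
  proof eventually_elim
    case (elim t)
    show ?case
    proof
      assume "a < t \<and> t < b"
      then have "(y has_derivative (\<lambda>s. s *\<^sub>R f (y t))) (at t)"
        using elim by (simp add: has_vector_derivative_def)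
      from has_derivative_compose[OF this Vd]
      have "((\<lambda>t. V (y t)) has_real_derivative (gradV (y t) \<bullet> f (y t))) (at t)"
        by (simp add: has_field_derivative_def inner_commute mult.commute[of _ "_ \<bullet> _"])
      from DERIV_mult[OF gd this]
      have "(h has_real_derivative (lam * g t * V (y t) + (gradV (y t) \<bullet> f (y t)) * g t)) (at t)"
        by (simp add: h_def[abs_def])
      moreover have "(gradV (y t) \<bullet> f (y t)) * g t \<le> (- lam * V (y t)) * g t"
        by (intro mult_right_mono decay) (simp add: g_def)
      ultimately show "\<exists>D\<le>0. (h has_real_derivative D) (at t)"
        by (intro exI conjI) (auto simp: algebra_simps)
    qed
  qed
  ultimately have "h b \<le> h a" using abs_continuous_on_AE_deriv_nonpos_imp_le ab by blast
  then have le: "exp (- lam * (b - a)) * h b \<le> exp (- lam * (b - a)) * h a"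
    by (intro mult_left_mono) auto
  have "exp (- lam * (b - a)) * g b = 1" by (simp add: g_def flip: exp_add)
  then have "exp (- lam * (b - a)) * h b = V (y b)" by (simp add: h_def flip: mult.assoc)
  moreover have "h a = V (y a)" by (simp add: h_def g_def)
  ultimately show ?thesis using le by metis
qed

subsection \<open>Holding times and modes\<close>

text \<open>The Laplace transform of the uniform law, from the antiderivative
  \<open>- exp (- (c * s)) / c\<close>; for \<open>c = 0\<close> the integrand is 1, in agreement
  with the convention in \<open>exp_ratio\<close>.\<close>

lemma nn_integral_exp_uniform:
  assumes T: "T > 0"
  shows "(\<integral>\<^sup>+ s. ennreal (exp (- (c * s))) \<partial>uniform_measure lborel {0..T}) = ennreal (exp_ratio (c * T))"
proof -
  have "(\<integral>\<^sup>+ s. ennreal (exp (- (c * s))) * indicator {0..T} s \<partial>lborel) = ennreal (T * exp_ratio (c * T))"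
  proof (cases "c = 0")
    case False
    have "(\<integral>\<^sup>+ s. ennreal (exp (- (c * s))) * indicator {0..T} s \<partial>lborel)
        = ennreal (- exp (- (c * T)) / c - - exp (- (c * 0)) / c)"
      using T False by (intro nn_integral_FTC_Icc) (auto intro!: derivative_eq_intros)
    also have "- exp (- (c * T)) / c - - exp (- (c * 0)) / c = T * exp_ratio (c * T)"
      using T False by (simp add: exp_ratio_def field_simps)
    finally show ?thesis .
  qed (use T in \<open>simp add: exp_ratio_def\<close>)
  moreover have "exp_ratio (c * T) \<ge> 0"
    unfolding exp_ratio_def by (auto simp: divide_simps)
  ultimately show ?thesis
    using T by (simp add: nn_integral_uniform_measure ennreal_mult divide_ennreal[symmetric] mult_ac
        flip: ennreal_mult) (simp add: divide_ennreal)
qed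

lemma exp_ratio_pos: "exp_ratio c > 0"
  unfolding exp_ratio_def by (auto simp: zero_less_divide_iff)

text \<open>This is \<open>1 - c < exp (- c)\<close>. It makes \<open>exp_ratio T\<close> the ratio
  of a convergent geometric series when the holding times are shown to have an infinite sum.\<close>

lemma exp_ratio_less_1: "c > 0 \<Longrightarrow> exp_ratio c < 1"
  using exp_minus_greater[of c] unfolding exp_ratio_def by (auto simp: divide_simps)

section \<open>Independence and conditioning\<close>

text \<open>A measurable function of \<open>X\<close> generates no more events than \<open>X\<close>
  does, and likewise for \<open>Y\<close>, so independence is inherited.\<close>

lemma (in prob_space) indep_var_of_indep_vimage_algebra:
  assumes indep: "indep_set (sets (vimage_algebra (space M) X S)) (sets (vimage_algebra (space M) Y R))"
    and X: "X \<in> space M \<rightarrow> space S" and Y: "Y \<in> space M \<rightarrow> space R"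
    and f: "f \<in> measurable S N1" and g: "g \<in> measurable R N2"
  shows "indep_var N1 (\<lambda>\<omega>. f (X \<omega>)) N2 (\<lambda>\<omega>. g (Y \<omega>))"
proof -
  let ?X = "vimage_algebra (space M) X S" and ?Y = "vimage_algebra (space M) Y R"
  have XY: "X \<in> measurable ?X S" "Y \<in> measurable ?Y R"
    using X Y by (auto intro: measurable_vimage_algebra1)
  \<comment> \<open>Independence of the sigma-algebras includes that their members are events;
    measurability of \<open>X\<close> and \<open>Y\<close> comes from there.\<close>
  have "X \<in> measurable M S" "Y \<in> measurable M R"
    using indep_setD_ev1[OF indep] indep_setD_ev2[OF indep] X Y by (simp_all add: measurable_iff_sets)
  then have rv: "random_variable N1 (\<lambda>\<omega>. f (X \<omega>))" "random_variable N2 (\<lambda>\<omega>. g (Y \<omega>))"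
    using f g by (auto intro: measurable_compose)
  have "{(\<lambda>\<omega>. f (X \<omega>)) -` A \<inter> space M |A. A \<in> sets N1} \<subseteq> sets ?X"
    using measurable_sets[OF measurable_compose[OF XY(1) f]] by auto
  from sets.sigma_sets_subset[OF this]
  have subX: "sigma_sets (space M) {(\<lambda>\<omega>. f (X \<omega>)) -` A \<inter> space M |A. A \<in> sets N1} \<subseteq> sets ?X"
    by simp
  have "{(\<lambda>\<omega>. g (Y \<omega>)) -` A \<inter> space M |A. A \<in> sets N2} \<subseteq> sets ?Y"
    using measurable_sets[OF measurable_compose[OF XY(2) g]] by auto
  from sets.sigma_sets_subset[OF this]
  have subY: "sigma_sets (space M) {(\<lambda>\<omega>. g (Y \<omega>)) -` A \<inter> space M |A. A \<in> sets N2} \<subseteq> sets ?Y"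
    by simp
  show ?thesis
    using indep rv subX subY unfolding indep_var_eq indep_sets2_eq by (meson subset_eq)
qed

lemma (in prob_space) indep_var_nn_integral:
  assumes "indep_var borel X borel Y" "\<And>\<omega>. X \<omega> \<ge> 0" "\<And>\<omega>. Y \<omega> \<ge> 0"
  shows "(\<integral>\<^sup>+\<omega>. X \<omega> * Y \<omega> \<partial>M) = (\<integral>\<^sup>+\<omega>. X \<omega> \<partial>M) * (\<integral>\<^sup>+\<omega>. Y \<omega> \<partial>M)"
proof -
  have eq: "case_bool borel borel = (\<lambda>_. borel)" by (auto split: bool.split)
  have "(\<integral>\<^sup>+\<omega>. (\<Prod>i\<in>UNIV. case_bool X Y i \<omega>) \<partial>M) = (\<Prod>i\<in>UNIV. \<integral>\<^sup>+\<omega>. case_bool X Y i \<omega> \<partial>M)"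
    by (rule indep_vars_nn_integral)
       (use assms in \<open>auto simp: indep_var_def eq split: bool.split\<close>)
  then show ?thesis by (simp add: UNIV_bool mult.commute)
qed

text \<open>The event that the past follows \<open>p\<close> lies in the sigma-algebra of the past,
  so integrating the conditional expectation over it gives the joint probability. In this form (UH2)
  can be iterated along a word of modes.\<close>

lemma (in prob_space) prob_next_given_past:
  fixes Y :: "nat \<Rightarrow> 'a \<Rightarrow> 'p::finite"
  assumes Y[measurable]: "\<And>j. Y j \<in> measurable M (count_space UNIV)"
    and cond: "AE \<omega> in M. real_cond_exp M
           (vimage_algebra (space M) (\<lambda>\<omega>. \<lambda>k\<in>{..<j}. Y k \<omega>) (PiM {..<j} (\<lambda>_. count_space UNIV)))
           (indicator {\<omega> \<in> space M. Y j \<omega> = i}) \<omega> = c"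
  shows "prob {\<omega> \<in> space M. (\<forall>k<j. Y k \<omega> = p k) \<and> Y j \<omega> = i} = c * prob {\<omega> \<in> space M. \<forall>k<j. Y k \<omega> = p k}"
proof -
  define S where "S = PiM {..<j} (\<lambda>_::nat. count_space (UNIV::'p set))"
  define G where "G = vimage_algebra (space M) (\<lambda>\<omega>. \<lambda>k\<in>{..<j}. Y k \<omega>) S"
  define A where "A = {\<omega> \<in> space M. \<forall>k<j. Y k \<omega> = p k}"
  define B where "B = {\<omega> \<in> space M. Y j \<omega> = i}"
  have Ym: "(\<lambda>\<omega>. \<lambda>k\<in>{..<j}. Y k \<omega>) \<in> measurable M S" unfolding S_def by measurable
  have [measurable]: "B \<in> events" unfolding B_def by measurable
  have "subalgebra M G"
    unfolding subalgebra_def G_def using Ym by (simp add: measurable_iff_sets)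
  interpret finite_measure_subalgebra M G
    by (intro finite_measure_subalgebra.intro finite_measure_subalgebra_axioms.intro
        finite_measure_axioms \<open>subalgebra M G\<close>)
  have "(\<lambda>k\<in>{..<j}. Y k \<omega>) \<in> PiE {..<j} (\<lambda>k. {p k}) \<longleftrightarrow> (\<forall>k<j. Y k \<omega> = p k)" for \<omega>
    by (simp add: PiE_iff Ball_def)
  then have "(\<lambda>\<omega>. \<lambda>k\<in>{..<j}. Y k \<omega>) -` (PiE {..<j} (\<lambda>k. {p k})) \<inter> space M = A"
    unfolding A_def vimage_def by blast
  moreover have "PiE {..<j} (\<lambda>k. {p k}) \<in> sets S" unfolding S_def by (intro sets_PiM_I_finite) auto
  ultimately have AG: "A \<in> sets G" unfolding G_def by (metis in_vimage_algebra)
  then have [measurable]: "A \<in> events" using subalg by (auto simp: subalgebra_def)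
  have "prob (A \<inter> B) = (\<integral>\<omega>\<in>A. indicator B \<omega> \<partial>M)"
    by (simp add: set_lebesgue_integral_def flip: indicator_inter_arith)
  also have "\<dots> = (\<integral>\<omega>\<in>A. real_cond_exp M G (indicator B) \<omega> \<partial>M)"
    by (intro real_cond_exp_intA[OF _ AG] integrable_real_indicator) (auto simp: less_top[symmetric])
  also have "\<dots> = (\<integral>\<omega>\<in>A. c \<partial>M)"
    unfolding set_lebesgue_integral_def using cond
    by (intro integral_cong_AE) (auto simp: G_def S_def B_def)
  also have "\<dots> = c * prob A" by (simp add: set_lebesgue_integral_def)
  finally show ?thesis unfolding A_def B_def
    by (simp add: Int_def conj_ac cong: conj_cong)
qed

section \<open>Exponentials of sums of holding times\<close>

text \<open>Expectations of products factorise by independence, and each factor is a Laplace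
  transform of the uniform law. The rates \<open>c k\<close> are deterministic; random modes are
  treated later by splitting according to their values.\<close>

lemma (in prob_space) nn_integral_prod_exp_uniform:
  assumes T: "T > 0" and indep: "indep_vars (\<lambda>_. borel) H {1..}"
    and distr: "\<And>i::nat. i \<ge> 1 \<Longrightarrow> distr M borel (H i) = uniform_measure lborel {0..T}"
  shows "(\<integral>\<^sup>+\<omega>. ennreal (\<Prod>k<N. exp (- (c k * H (Suc k) \<omega>))) \<partial>M) = ennreal (\<Prod>k<N. exp_ratio (c k * T))"
proof -
  \<comment> \<open>Rates are numbered from 0 and holding times from 1, hence
    \<open>c (i - 1)\<close> beside \<open>H i\<close>.\<close>
  have ind: "indep_vars (\<lambda>_. borel) (\<lambda>i \<omega>. ennreal (exp (- (c (i - 1) * H i \<omega>)))) {1..N}"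
    by (rule indep_vars_compose2[OF indep_vars_subset[OF indep]]) auto
  have one: "(\<integral>\<^sup>+\<omega>. ennreal (exp (- (c k * H (Suc k) \<omega>))) \<partial>M) = ennreal (exp_ratio (c k * T))" for k
  proof -
    have "H (Suc k) \<in> borel_measurable M" using indep by (auto simp: indep_vars_def)
    then have "(\<integral>\<^sup>+\<omega>. ennreal (exp (- (c k * H (Suc k) \<omega>))) \<partial>M)
        = (\<integral>\<^sup>+s. ennreal (exp (- (c k * s))) \<partial>distr M borel (H (Suc k)))"
      by (simp add: nn_integral_distr)
    then show ?thesis using distr[of "Suc k"] nn_integral_exp_uniform[OF T] by simp
  qed
  have "(\<integral>\<^sup>+\<omega>. ennreal (\<Prod>k<N. exp (- (c k * H (Suc k) \<omega>))) \<partial>M)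
      = (\<integral>\<^sup>+\<omega>. (\<Prod>i\<in>{1..N}. ennreal (exp (- (c (i - 1) * H i \<omega>)))) \<partial>M)"
    by (simp only: One_nat_def prod.atLeast1_atMost_eq) (simp add: prod_ennreal)
  also have "\<dots> = (\<Prod>i\<in>{1..N}. \<integral>\<^sup>+\<omega>. ennreal (exp (- (c (i - 1) * H i \<omega>))) \<partial>M)"
    by (rule indep_vars_nn_integral[OF _ ind]) auto
  also have "\<dots> = (\<Prod>k<N. ennreal (exp_ratio (c k * T)))"
    by (simp only: One_nat_def prod.atLeast1_atMost_eq) (simp add: one)
  also have "\<dots> = ennreal (\<Prod>k<N. exp_ratio (c k * T))"
    by (simp add: prod_ennreal less_imp_le exp_ratio_pos)
  finally show ?thesis .
qed

text \<open>The expectation of \<open>\<Sum>N. exp (- (H 1 + \<dots> + H N))\<close> is a convergent geometric series.\<close>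

lemma (in prob_space) AE_sum_uniform_unbounded:
  assumes T: "T > 0" and indep: "indep_vars (\<lambda>_. borel) H {1..}"
    and distr: "\<And>i::nat. i \<ge> 1 \<Longrightarrow> distr M borel (H i) = uniform_measure lborel {0..T}"
  shows "AE \<omega> in M. \<forall>t::real. \<exists>N. t < (\<Sum>k<N. H (Suc k) \<omega>)"
proof -
  have [measurable]: "H (Suc k) \<in> borel_measurable M" for k using indep by (auto simp: indep_vars_def)
  define Z where "Z N \<omega> = exp (- (\<Sum>k<N. H (Suc k) \<omega>))" for N \<omega>
  have Z_meas [measurable]: "Z N \<in> borel_measurable M" for N unfolding Z_def by measurable
  define c where "c = exp_ratio T"
  have c: "0 < c" "c < 1" using exp_ratio_pos exp_ratio_less_1 T by (auto simp: c_def)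
  have "(\<integral>\<^sup>+\<omega>. ennreal (Z N \<omega>) \<partial>M) = ennreal (c ^ N)" for N
    using nn_integral_prod_exp_uniform[OF T indep distr, where c = "\<lambda>_. 1" and N = N]
    by (simp add: Z_def c_def exp_sum flip: sum_negf)
  then have "(\<integral>\<^sup>+\<omega>. (\<Sum>N. ennreal (Z N \<omega>)) \<partial>M) = (\<Sum>N. ennreal (c ^ N))"
    by (subst nn_integral_suminf) auto
  also have "\<dots> = ennreal (\<Sum>N. c ^ N)" using c by (intro suminf_ennreal2) (auto intro: summable_geometric)
  finally have "AE \<omega> in M. (\<Sum>N. ennreal (Z N \<omega>)) \<noteq> \<infinity>"
    by (intro nn_integral_noteq_infinite) auto
  then show ?thesis
  proof eventually_elim
    case (elim \<omega>)
    then have "summable (\<lambda>N. Z N \<omega>)"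
      by (intro summable_suminf_not_top) (auto simp: Z_def)
    \<comment> \<open>The terms of a convergent series tend to 0, and
      \<open>Z N \<omega> < exp (- t)\<close> says exactly that the first \<open>N\<close> holding
      times add up to more than \<open>t\<close>.\<close>
    then have "(\<lambda>N. Z N \<omega>) \<longlonglongrightarrow> 0" by (rule summable_LIMSEQ_zero)
    then have "\<forall>\<^sub>F N in sequentially. Z N \<omega> < exp (- t)" for t
      by (rule order_tendstoD) simp
    then have "\<exists>N. Z N \<omega> < exp (- t)" for t
      by (meson eventually_sequentially order_refl)
    then show ?case by (simp add: Z_def)
  qed
qed

lemma (in prob_space) AE_uniform_bounds:
  fixes X :: "'a \<Rightarrow> real"
  assumes X: "X \<in> borel_measurable M"
    and distr: "distr M borel X = uniform_measure lborel {0..T}"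
  shows "AE \<omega> in M. X \<omega> \<in> {0..T}"
proof -
  have "AE s in uniform_measure lborel {0..T}. s \<in> {0..T}"
    by (intro AE_uniform_measureI) (auto simp: sets_lborel)
  from this[folded distr] show ?thesis by (rule AE_distrD[OF X])
qed

section \<open>Words of modes and the expected growth factor\<close>

text \<open>Induction on \<open>N\<close>: each mode after the first multiplies the probability by
  its weight \<open>q\<close>. Index 0 is special since the initial mode is the fixed
  \<open>i0\<close>, not drawn with the weights \<open>q\<close>.\<close>

lemma (in prob_space) prob_initial_segment_le:
  fixes Y :: "nat \<Rightarrow> 'a \<Rightarrow> 'p::finite"
  assumes Y[measurable]: "\<And>j. Y j \<in> measurable M (count_space UNIV)"
    and init: "AE \<omega> in M. Y 0 \<omega> = i0"
    and cond: "\<And>j i. j \<ge> 1 \<Longrightarrow> AE \<omega> in M. real_cond_exp M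
           (vimage_algebra (space M) (\<lambda>\<omega>. \<lambda>k\<in>{..<j}. Y k \<omega>) (PiM {..<j} (\<lambda>_. count_space UNIV)))
           (indicator {\<omega> \<in> space M. Y j \<omega> = i}) \<omega> = q i"
    and q: "\<And>i. q i \<ge> 0"
  shows "prob {\<omega> \<in> space M. \<forall>k<N. Y k \<omega> = p k} \<le> (\<Prod>k<N. if k = 0 then of_bool (p k = i0) else q (p k))"
proof (induction N)
  case (Suc N)
  have eq: "{\<omega> \<in> space M. \<forall>k<Suc N. Y k \<omega> = p k} = {\<omega> \<in> space M. (\<forall>k<N. Y k \<omega> = p k) \<and> Y N \<omega> = p N}"
    by (auto simp: less_Suc_eq)
  show ?case
  proof (cases "N = 0")
    case True
    have "prob {\<omega> \<in> space M. Y 0 \<omega> = p 0} = 0" if "p 0 \<noteq> i0"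
      using init that by (intro prob_eq_0_AE) auto
    then show ?thesis using True by (auto simp: eq)
  next
    case False
    then have "prob {\<omega> \<in> space M. \<forall>k<Suc N. Y k \<omega> = p k} = q (p N) * prob {\<omega> \<in> space M. \<forall>k<N. Y k \<omega> = p k}"
      unfolding eq by (intro prob_next_given_past cond) auto
    also have "\<dots> \<le> q (p N) * (\<Prod>k<N. if k = 0 then of_bool (p k = i0) else q (p k))"
      by (intro mult_left_mono Suc.IH q)
    finally show ?thesis using False by (simp add: mult.commute)
  qed
qed simp

text \<open>The product is split according to the first \<open>N + 1\<close> modes. On a fixed word
  \<open>p\<close> it depends on the holding times only, which are independent of the modes, so its
  expectation is bounded by a product over \<open>k\<close>; summing over all words gives a product
  of sums. The factor at index 0 stands apart because the initial mode is deterministic.\<close>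

lemma (in prob_space) nn_integral_prod_modulated_exp_le:
  fixes Y :: "nat \<Rightarrow> 'a \<Rightarrow> 'p::finite"
  assumes T: "T > 0" and indep: "indep_vars (\<lambda>_. borel) H {1..}"
    and distr: "\<And>i::nat. i \<ge> 1 \<Longrightarrow> distr M borel (H i) = uniform_measure lborel {0..T}"
    and init: "AE \<omega> in M. Y 0 \<omega> = i0"
    and cond: "\<And>j i. j \<ge> 1 \<Longrightarrow> AE \<omega> in M. real_cond_exp M
           (vimage_algebra (space M) (\<lambda>\<omega>. \<lambda>k\<in>{..<j}. Y k \<omega>) (PiM {..<j} (\<lambda>_. count_space UNIV)))
           (indicator {\<omega> \<in> space M. Y j \<omega> = i}) \<omega> = q i"
    and q: "\<And>i. q i \<ge> 0" and \<mu>: "\<mu> \<ge> 0"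
    and HY: "indep_set
        (sets (vimage_algebra (space M) (\<lambda>\<omega>. \<lambda>i\<in>{1..}. H i \<omega>) (PiM {1..} (\<lambda>_. borel))))
        (sets (vimage_algebra (space M) (\<lambda>\<omega> i. Y i \<omega>) (PiM UNIV (\<lambda>_. count_space UNIV))))"
  shows "(\<integral>\<^sup>+\<omega>. ennreal (\<Prod>k<Suc N. \<mu> * exp (- (lam (Y k \<omega>) * H (Suc k) \<omega>))) \<partial>M)
     \<le> ennreal (\<mu> * exp_ratio (lam i0 * T) * (\<Sum>i\<in>UNIV. \<mu> * q i * exp_ratio (lam i * T)) ^ N)"
proof -
  have [measurable]: "H (Suc k) \<in> borel_measurable M" for k using indep by (auto simp: indep_vars_def)
  have Ym: "(\<lambda>\<omega> i. Y i \<omega>) \<in> measurable M (PiM UNIV (\<lambda>_. count_space UNIV))"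
    using indep_setD_ev2[OF HY] by (simp add: measurable_iff_sets space_PiM)
  have Y[measurable]: "Y j \<in> measurable M (count_space UNIV)" for j
    using measurable_compose[OF Ym measurable_component_singleton[of j]] by simp
  define n where "n = Suc N"
  define P where "P = PiE {..<n} (\<lambda>_. UNIV :: 'p set)"
  define w where "w k i = (if k = 0 then of_bool (i = i0) else q i)" for k :: nat and i
  define A where "A p = {\<omega> \<in> space M. \<forall>k<n. Y k \<omega> = p k}" for p :: "nat \<Rightarrow> 'p"
  define G where "G p \<omega> = (\<Prod>k<n. \<mu> * exp (- (lam (p k) * H (Suc k) \<omega>)))" for p \<omega>
  have A[measurable]: "A p \<in> events" for p unfolding A_def by measurable
  have G[measurable]: "G p \<in> borel_measurable M" for p unfolding G_def by measurable
  have G0: "G p \<omega> \<ge> 0" for p \<omega> using \<mu> by (auto simp: G_def intro!: prod_nonneg)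
  have expand: "(\<Prod>k<n. \<mu> * exp (- (lam (Y k \<omega>) * H (Suc k) \<omega>))) = (\<Sum>p\<in>P. G p \<omega> * indicator (A p) \<omega>)"
    if "\<omega> \<in> space M" for \<omega>
  proof -
    \<comment> \<open>Each factor is written as a sum over all modes with a single nonzero term;
      distributing the product over these sums leaves one term per word.\<close>
    have "(\<Prod>k<n. \<mu> * exp (- (lam (Y k \<omega>) * H (Suc k) \<omega>)))
        = (\<Prod>k<n. \<Sum>i\<in>UNIV. \<mu> * exp (- (lam i * H (Suc k) \<omega>)) * of_bool (Y k \<omega> = i))"
      by (intro prod.cong refl) (simp add: of_bool_def if_distrib sum.delta cong: if_cong)
    also have "\<dots> = (\<Sum>p\<in>P. \<Prod>k<n. \<mu> * exp (- (lam (p k) * H (Suc k) \<omega>)) * of_bool (Y k \<omega> = p k))"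
      unfolding P_def by (rule prod_sum_PiE) auto
    also have "\<dots> = (\<Sum>p\<in>P. G p \<omega> * indicator (A p) \<omega>)"
    proof (intro sum.cong refl)
      fix p
      have "(\<Prod>k<n. of_bool (Y k \<omega> = p k)) = (indicator (A p) \<omega> :: real)"
        using that by (auto simp: A_def indicator_def of_bool_def intro!: prod.neutral)
      then show "(\<Prod>k<n. \<mu> * exp (- (lam (p k) * H (Suc k) \<omega>)) * of_bool (Y k \<omega> = p k)) = G p \<omega> * indicator (A p) \<omega>"
        by (simp add: G_def prod.distrib)
    qed
    finally show ?thesis .
  qed
  have intG: "(\<integral>\<^sup>+\<omega>. ennreal (G p \<omega>) \<partial>M) = ennreal (\<Prod>k<n. \<mu> * exp_ratio (lam (p k) * T))" for p
  proof -
    have "G p \<omega> = \<mu> ^ n * (\<Prod>k<n. exp (- (lam (p k) * H (Suc k) \<omega>)))" for \<omega>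
      by (simp add: G_def prod.distrib)
    then have "(\<integral>\<^sup>+\<omega>. ennreal (G p \<omega>) \<partial>M) = ennreal (\<mu> ^ n) * (\<integral>\<^sup>+\<omega>. ennreal (\<Prod>k<n. exp (- (lam (p k) * H (Suc k) \<omega>))) \<partial>M)"
      using \<mu> by (simp add: ennreal_mult prod_nonneg nn_integral_cmult)
    also have "\<dots> = ennreal (\<mu> ^ n) * ennreal (\<Prod>k<n. exp_ratio (lam (p k) * T))"
      by (subst nn_integral_prod_exp_uniform[OF T indep distr, where c = "\<lambda>k. lam (p k)"]) auto
    also have "\<dots> = ennreal (\<Prod>k<n. \<mu> * exp_ratio (lam (p k) * T))"
      using \<mu> by (simp add: prod.distrib ennreal_mult prod_nonneg less_imp_le exp_ratio_pos)
    finally show ?thesis .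
  qed
  have term_le: "(\<integral>\<^sup>+\<omega>. ennreal (G p \<omega> * indicator (A p) \<omega>) \<partial>M)
      \<le> ennreal (\<Prod>k<n. w k (p k) * (\<mu> * exp_ratio (lam (p k) * T)))" for p
  proof -
    \<comment> \<open>As functions of whole sequences, \<open>G'\<close> and \<open>A'\<close> fit
      the independence hypothesis; \<open>G'\<close> reads only coordinates from 1 on, so the
      restriction to \<open>{1..}\<close> does not affect it.\<close>
    define G' where "G' h = ennreal (\<Prod>k<n. \<mu> * exp (- (lam (p k) * h (Suc k))))" for h :: "nat \<Rightarrow> real"
    define A' where "A' y = (indicator {y. \<forall>k<n. y k = p k} y :: ennreal)" for y :: "nat \<Rightarrow> 'p"
    define E where "E = (\<Prod>k<n. \<mu> * exp_ratio (lam (p k) * T))"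
    have "G' \<in> borel_measurable (PiM {1..} (\<lambda>_. borel))" unfolding G'_def by measurable
    moreover have "A' \<in> borel_measurable (PiM UNIV (\<lambda>_. count_space UNIV))"
      unfolding A'_def by measurable
    ultimately have "indep_var borel (\<lambda>\<omega>. G' (\<lambda>i\<in>{1..}. H i \<omega>)) borel (\<lambda>\<omega>. A' (\<lambda>i. Y i \<omega>))"
      by (intro indep_var_of_indep_vimage_algebra[OF HY]) (auto simp: space_PiM)
    then have "indep_var borel (\<lambda>\<omega>. ennreal (G p \<omega>)) borel (\<lambda>\<omega>. A' (\<lambda>i. Y i \<omega>))"
      by (simp add: G'_def G_def)
    from indep_var_nn_integral[OF this]
    have "(\<integral>\<^sup>+\<omega>. ennreal (G p \<omega>) * A' (\<lambda>i. Y i \<omega>) \<partial>M) = (\<integral>\<^sup>+\<omega>. ennreal (G p \<omega>) \<partial>M) * (\<integral>\<^sup>+\<omega>. A' (\<lambda>i. Y i \<omega>) \<partial>M)"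
      by simp
    moreover have A'_eq: "A' (\<lambda>i. Y i \<omega>) = indicator (A p) \<omega>" if "\<omega> \<in> space M" for \<omega>
      using that by (auto simp: A'_def A_def indicator_def)
    moreover have "(\<integral>\<^sup>+\<omega>. A' (\<lambda>i. Y i \<omega>) \<partial>M) = (\<integral>\<^sup>+\<omega>. indicator (A p) \<omega> \<partial>M)"
      by (rule nn_integral_cong) (rule A'_eq)
    then have "(\<integral>\<^sup>+\<omega>. A' (\<lambda>i. Y i \<omega>) \<partial>M) = ennreal (prob (A p))"
      by (simp add: emeasure_eq_measure)
    ultimately have "(\<integral>\<^sup>+\<omega>. ennreal (G p \<omega>) * indicator (A p) \<omega> \<partial>M) = ennreal E * ennreal (prob (A p))"
      using intG[of p] by (simp add: E_def cong: nn_integral_cong)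
    moreover have "ennreal (G p \<omega> * indicator (A p) \<omega>) = ennreal (G p \<omega>) * indicator (A p) \<omega>" for \<omega>
      by (simp add: indicator_def)
    moreover have E0: "E \<ge> 0"
      using \<mu> by (auto intro!: prod_nonneg simp: E_def less_imp_le exp_ratio_pos)
    moreover have "prob (A p) \<le> (\<Prod>k<n. w k (p k))"
      unfolding A_def w_def by (rule prob_initial_segment_le[OF Y init cond q])
    then have "E * prob (A p) \<le> E * (\<Prod>k<n. w k (p k))"
      using E0 by (rule mult_left_mono)
    moreover have "(\<Prod>k<n. w k (p k) * (\<mu> * exp_ratio (lam (p k) * T))) = E * (\<Prod>k<n. w k (p k))"
      by (simp only: E_def prod.distrib) simp
    ultimately show ?thesis
      by (simp add: ennreal_leI flip: ennreal_mult')
  qed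
  have w0: "w k i * (\<mu> * exp_ratio (lam i * T)) \<ge> 0" for k i
    using q \<mu> by (simp add: w_def less_imp_le exp_ratio_pos)
  have finP: "finite P" unfolding P_def by (intro finite_PiE) auto
  have "(\<integral>\<^sup>+\<omega>. ennreal (\<Prod>k<n. \<mu> * exp (- (lam (Y k \<omega>) * H (Suc k) \<omega>))) \<partial>M)
      = (\<integral>\<^sup>+\<omega>. (\<Sum>p\<in>P. ennreal (G p \<omega> * indicator (A p) \<omega>)) \<partial>M)"
    by (intro nn_integral_cong) (simp add: expand G0)
  also have "\<dots> = (\<Sum>p\<in>P. \<integral>\<^sup>+\<omega>. ennreal (G p \<omega> * indicator (A p) \<omega>) \<partial>M)"
    by (rule nn_integral_sum) auto
  also have "\<dots> \<le> (\<Sum>p\<in>P. ennreal (\<Prod>k<n. w k (p k) * (\<mu> * exp_ratio (lam (p k) * T))))"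
    by (intro sum_mono term_le)
  also have "\<dots> = ennreal (\<Sum>p\<in>P. \<Prod>k<n. w k (p k) * (\<mu> * exp_ratio (lam (p k) * T)))"
    by (intro sum_ennreal prod_nonneg w0)
  \<comment> \<open>The distributive law backwards. Afterwards position 0 contributes only the term
    of \<open>i0\<close>, and every later position the same sum.\<close>
  also have "(\<Sum>p\<in>P. \<Prod>k<n. w k (p k) * (\<mu> * exp_ratio (lam (p k) * T)))
      = (\<Prod>k<n. \<Sum>i\<in>UNIV. w k i * (\<mu> * exp_ratio (lam i * T)))"
    unfolding P_def by (rule prod_sum_PiE[symmetric]) auto
  also have "\<dots> = \<mu> * exp_ratio (lam i0 * T) * (\<Sum>i\<in>UNIV. \<mu> * q i * exp_ratio (lam i * T)) ^ N"
  proof -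
    have "(\<Sum>i\<in>UNIV. w 0 i * (\<mu> * exp_ratio (lam i * T))) = \<mu> * exp_ratio (lam i0 * T)"
      by (simp add: w_def of_bool_def if_distrib[of "\<lambda>x. x * _"] cong: if_cong)
    then show ?thesis
      unfolding n_def prod.lessThan_Suc_shift by (simp add: w_def mult_ac)
  qed
  finally show ?thesis by (simp add: n_def)
qed

subsection \<open>Stability\<close>

text \<open>Induction over the switching intervals: in each one the Lyapunov function of the active
  mode is controlled by its decay rate, and changing the mode at the right end costs a factor \<mu>.
  The interval for \<open>u\<close> is closed on the right so that the induction hypothesis can be
  evaluated at the switching instant, still with the function of the old mode.\<close>

lemma switched_Lyapunov_bound:
  fixes V :: "'p \<Rightarrow> 'a::euclidean_space \<Rightarrow> real"
  assumes V: "\<And>i z. GDERIV (V i) z :> gradV i z" "\<And>i. continuous_on UNIV (gradV i)"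
    and decay: "\<And>i z. gradV i z \<bullet> f i z \<le> - lam i * V i z"
    and \<mu>: "\<mu> \<ge> 0" "\<And>i j z. V i z \<le> \<mu> * V j z"
    and sol: "caratheodory_solution f s x0 y"
    and t0: "t 0 = 0" and inc: "\<And>i. t i < t (Suc i)"
    and const: "\<And>i u. u \<in> {t i..<t (Suc i)} \<Longrightarrow> s u = s (t i)"
    and u: "u \<in> {t N..t (Suc N)}"
  shows "V (s (t N)) (y u) \<le> exp (- lam (s (t N)) * (u - t N)) *
           ((\<Prod>k<N. \<mu> * exp (- (lam (s (t k)) * (t (Suc k) - t k)))) * V (s (t 0)) x0)"
  using u
proof (induction N arbitrary: u)
  \<comment> \<open>At the right end point \<open>s\<close> may already have switched, but the
    differential equation is used only in the open interval.\<close>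
  have step: "V (s (t N)) (y u) \<le> exp (- lam (s (t N)) * (u - t N)) * V (s (t N)) (y (t N))"
    if u: "u \<in> {t N..t (Suc N)}" for N u
  proof (rule Lyapunov_decay[OF V decay])
    have "t 0 \<le> t N" by (rule lift_Suc_mono_le) (use inc less_imp_le in auto)
    then have "t N \<ge> 0" using t0 by simp
    have "abs_continuous_on 0 u y"
      using sol u \<open>t N \<ge> 0\<close> by (auto simp: caratheodory_solution_def)
    then show "abs_continuous_on (t N) u y"
      by (rule abs_continuous_on_subset) (use \<open>t N \<ge> 0\<close> in auto)
    have "AE r in lborel. r > 0 \<longrightarrow> (y has_vector_derivative f (s r) (y r)) (at r)"
      using sol by (simp add: caratheodory_solution_def)
    then show "AE r in lborel. t N < r \<and> r < u \<longrightarrow> (y has_vector_derivative f (s (t N)) (y r)) (at r)"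
    proof eventually_elim
      case (elim r)
      then show ?case using const[of r N] u \<open>t N \<ge> 0\<close> by auto
    qed
  qed (use u in auto)
  {
    case 0
    then show ?case using step[of u 0] sol t0 by (simp add: caratheodory_solution_def)
  next
    case (Suc N)
    let ?P = "\<lambda>N. (\<Prod>k<N. \<mu> * exp (- (lam (s (t k)) * (t (Suc k) - t k)))) * V (s (t 0)) x0"
    have "V (s (t N)) (y (t (Suc N))) \<le> exp (- lam (s (t N)) * (t (Suc N) - t N)) * ?P N"
      by (rule Suc.IH) (use inc[of N] in simp)
    then have "\<mu> * V (s (t N)) (y (t (Suc N))) \<le> \<mu> * (exp (- lam (s (t N)) * (t (Suc N) - t N)) * ?P N)"
      using \<mu>(1) by (rule mult_left_mono)
    also have "\<dots> = ?P (Suc N)" by simp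
    finally have "V (s (t (Suc N))) (y (t (Suc N))) \<le> ?P (Suc N)"
      using \<mu>(2) order_trans by blast
    then have "exp (- lam (s (t (Suc N))) * (u - t (Suc N))) * V (s (t (Suc N))) (y (t (Suc N)))
        \<le> exp (- lam (s (t (Suc N))) * (u - t (Suc N))) * ?P (Suc N)"
      by (rule mult_left_mono) simp
    with step[OF Suc.prems] show ?case by (rule order_trans)
  }
qed

lemma unbounded_seq_interval:
  fixes t :: "nat \<Rightarrow> real"
  assumes "t 0 \<le> u" "\<exists>N. u < t N"
  obtains N where "t N \<le> u" "u < t (Suc N)"
proof -
  define m where "m = (LEAST N. u < t N)"
  have m: "u < t m" unfolding m_def using assms(2) by (rule LeastI_ex)
  with assms(1) obtain N where N: "m = Suc N" by (cases m) auto
  have "\<not> u < t N" using not_less_Least[of N "\<lambda>N. u < t N"] N by (simp add: m_def)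
  then show ?thesis using that[of N] m N by simp
qed

section \<open>Stability from a summable bound\<close>

text \<open>With \<open>n = 0\<close> the bound is a constant multiple of
  \<open>\<alpha>2 (norm x0)\<close>, small near the origin by continuity. For (SM2) the tail of the
  series is small for large \<open>n\<close>, and monotonicity of \<open>\<alpha>2\<close> makes the
  estimate uniform in \<open>norm x0 < r\<close>; \<open>n * T\<close> is then the waiting
  time.\<close>

lemma gas_in_meanI:
  fixes x :: "'a::real_normed_vector \<Rightarrow> real \<Rightarrow> 'w \<Rightarrow> 'a" and b :: "nat \<Rightarrow> real"
  assumes \<alpha>2: "class_K \<alpha>2" and b: "summable b" "\<And>N. b N \<ge> 0" and K: "K \<ge> 0"
    and bound: "\<And>n x0 u. u \<ge> real n * T \<Longrightarrow> u \<ge> 0 \<Longrightarrow>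
      (\<integral>\<^sup>+ \<omega>. ennreal (\<alpha> (norm (x x0 u \<omega>))) \<partial>M) \<le> ennreal (K * \<alpha>2 (norm x0) * (\<Sum>j. b (j + n)))"
    and T: "T \<ge> 0"
  shows "gas_in_mean M \<alpha> x"
  unfolding gas_in_mean_def
proof (intro conjI allI impI)
  have mono: "\<alpha>2 r \<le> \<alpha>2 s" if "0 \<le> r" "r \<le> s" for r s
    using \<alpha>2 that unfolding class_K_def by (auto intro: strict_mono_on_leD)
  have pos: "\<alpha>2 r \<ge> 0" if "0 \<le> r" for r
    using mono[OF order_refl that] \<alpha>2 by (simp add: class_K_def)
  have sum0: "(\<Sum>j. b (j + n)) \<ge> 0" for n
    by (intro suminf_nonneg b summable_ignore_initial_segment)
  fix \<epsilon> :: real assume \<epsilon>: "\<epsilon> > 0"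
  {
    define C where "C = K * suminf b"
    have C: "C \<ge> 0" using K sum0[of 0] by (simp add: C_def)
    have "continuous_on {0..} \<alpha>2" "\<alpha>2 0 = 0" using \<alpha>2 by (auto simp: class_K_def)
    \<comment> \<open>Dividing by \<open>C + 1\<close> is safe also for \<open>C = 0\<close>, and
      aiming at \<open>\<epsilon> / 2\<close> keeps the inequality strict after taking the supremum.
      The same device serves for the tail below.\<close>
    then obtain d where d: "d > 0" "\<And>r. r \<ge> 0 \<Longrightarrow> r < d \<Longrightarrow> \<bar>\<alpha>2 r\<bar> < \<epsilon> / (2 * (C + 1))"
      using \<epsilon> C unfolding continuous_on_iff
      by (force simp: dist_real_def dest: bspec[of _ _ 0] spec[of _ "\<epsilon> / (2 * (C + 1))"])
    show "\<exists>\<delta>>0. \<forall>x0. norm x0 < \<delta> \<longrightarrow> (SUP t\<in>{0..}. \<integral>\<^sup>+ \<omega>. ennreal (\<alpha> (norm (x x0 t \<omega>))) \<partial>M) < ennreal \<epsilon>"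
    proof (intro exI[of _ d] conjI allI impI d(1))
      fix x0 :: 'a assume x0: "norm x0 < d"
      have "(SUP t\<in>{0..}. \<integral>\<^sup>+ \<omega>. ennreal (\<alpha> (norm (x x0 t \<omega>))) \<partial>M) \<le> ennreal (C * \<alpha>2 (norm x0))"
        using bound[of 0] by (intro SUP_least) (simp add: C_def mult_ac)
      also have "\<dots> \<le> ennreal (\<epsilon> / 2)"
      proof (rule ennreal_leI)
        have "C * \<alpha>2 (norm x0) \<le> (C + 1) * (\<epsilon> / (2 * (C + 1)))"
          using d(2)[OF norm_ge_zero x0] pos[of "norm x0"] C by (intro mult_mono) auto
        also have "\<dots> = \<epsilon> / 2" using C by (simp add: field_simps)
        finally show "C * \<alpha>2 (norm x0) \<le> \<epsilon> / 2" .
      qed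
      also have "\<dots> < ennreal \<epsilon>" using \<epsilon> by (simp add: ennreal_less_iff)
      finally show "(SUP t\<in>{0..}. \<integral>\<^sup>+ \<omega>. ennreal (\<alpha> (norm (x x0 t \<omega>))) \<partial>M) < ennreal \<epsilon>" .
    qed
  next
    fix r :: real assume r: "r > 0"
    define C where "C = K * \<alpha>2 r"
    have C: "C \<ge> 0" using K pos r by (simp add: C_def)
    obtain n where "\<forall>m\<ge>n. norm (\<Sum>j. b (j + m)) < \<epsilon> / (2 * (C + 1))"
      using suminf_exist_split[OF _ b(1), of "\<epsilon> / (2 * (C + 1))"] \<epsilon> C by auto
    then have n: "(\<Sum>j. b (j + n)) < \<epsilon> / (2 * (C + 1))" by auto
    show "\<exists>T\<ge>0. \<forall>x0. norm x0 < r \<longrightarrow> (SUP t\<in>{T..}. \<integral>\<^sup>+ \<omega>. ennreal (\<alpha> (norm (x x0 t \<omega>))) \<partial>M) < ennreal \<epsilon>"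
    proof (intro exI[of _ "real n * T"] conjI allI impI)
      show "real n * T \<ge> 0" using T by simp
      fix x0 :: 'a assume x0: "norm x0 < r"
      have "(SUP t\<in>{real n * T..}. \<integral>\<^sup>+ \<omega>. ennreal (\<alpha> (norm (x x0 t \<omega>))) \<partial>M)
          \<le> ennreal (K * \<alpha>2 (norm x0) * (\<Sum>j. b (j + n)))"
        using T by (intro SUP_least bound) (auto intro: order_trans[of 0 "real n * T"])
      also have "\<dots> \<le> ennreal (\<epsilon> / 2)"
      proof (rule ennreal_leI)
        have "K * \<alpha>2 (norm x0) \<le> C + 1"
          using mono[of "norm x0" r] x0 K by (auto simp: C_def intro!: add_increasing2 mult_left_mono)
        then have "K * \<alpha>2 (norm x0) * (\<Sum>j. b (j + n)) \<le> (C + 1) * (\<epsilon> / (2 * (C + 1)))"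
          using n C sum0 by (intro mult_mono) auto
        also have "\<dots> = \<epsilon> / 2" using C by (simp add: field_simps)
        finally show "K * \<alpha>2 (norm x0) * (\<Sum>j. b (j + n)) \<le> \<epsilon> / 2" .
      qed
      also have "\<dots> < ennreal \<epsilon>" using \<epsilon> by (simp add: ennreal_less_iff)
      finally show "(SUP t\<in>{real n * T..}. \<integral>\<^sup>+ \<omega>. ennreal (\<alpha> (norm (x x0 t \<omega>))) \<partial>M) < ennreal \<epsilon>" .
    qed
  }
qed

theorem corollary3p5:
  fixes M :: "'w measure"
    and f :: "'p::finite \<Rightarrow> real ^ 'n \<Rightarrow> real ^ 'n"
    and \<sigma> :: "real \<Rightarrow> 'w \<Rightarrow> 'p" and \<sigma>0 :: 'p and \<tau> :: "nat \<Rightarrow> 'w \<Rightarrow> real"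
    and x :: "real ^ 'n \<Rightarrow> real \<Rightarrow> 'w \<Rightarrow> real ^ 'n"
    and V :: "'p \<Rightarrow> real ^ 'n \<Rightarrow> real" and gradV :: "'p \<Rightarrow> real ^ 'n \<Rightarrow> real ^ 'n"
    and \<alpha>1 \<alpha>2 :: "real \<Rightarrow> real" and \<mu> T :: real and lam q :: "'p \<Rightarrow> real"
  assumes "prob_space M" and "complete_measure M"
    and "\<And>i. local_lipschitz (UNIV :: real set) UNIV (\<lambda>_. f i)"
    and "\<And>i. f i 0 = 0"
    and "switching_signal M \<sigma>0 \<sigma> \<tau>"
    and "state_process M f \<sigma> x"
    and U1_C1: "\<And>i z. GDERIV (V i) z :> gradV i z" "\<And>i. continuous_on UNIV (gradV i)"
    and U1_K: "class_K_inf \<alpha>1" "class_K_inf \<alpha>2"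
    and U1_bounds: "\<And>i z. \<alpha>1 (norm z) \<le> V i z \<and> V i z \<le> \<alpha>2 (norm z)"
    and U1_decay: "\<And>i z. gradV i z \<bullet> f i z \<le> - lam i * V i z"
    and U1_mu: "\<mu> > 1" "\<And>i j z. V i z \<le> \<mu> * V j z"
    and U2: "class_UH M \<sigma> \<tau> T q"
    and U3: "(\<Sum>i\<in>UNIV. \<mu> * q i * exp_ratio (lam i * T)) < 1"
  shows "gas_in_mean M \<alpha>1 x"
proof -
  interpret prob_space M by fact
  define H where "H = holding_time \<tau>"
  define Y where "Y = mode_at \<sigma> \<tau>"
  define g where "g i = \<mu> * exp_ratio (lam i * T)" for i
  define \<rho> where "\<rho> = (\<Sum>i\<in>UNIV. \<mu> * q i * exp_ratio (lam i * T))"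
  \<comment> \<open>\<open>b N\<close> will bound the expectation of \<open>F N\<close>: the empty
    product has expectation 1, the first factor belongs to the deterministic mode
    \<open>\<sigma>0\<close>, and the other \<open>N - 1\<close> factors each bring a
    \<open>\<rho>\<close>.\<close>
  define b where "b N = (if N = 0 then 1 else g \<sigma>0 * \<rho> ^ (N - 1))" for N
  define F where "F N \<omega> = (\<Prod>k<N. \<mu> * exp (- (lam (Y k \<omega>) * H (Suc k) \<omega>)))" for N \<omega>
  \<comment> \<open>Bounds the growth since the last switch, at most \<open>T\<close> ago; the sum
    of the \<open>\<bar>lam i\<bar>\<close> dominates the rate of whichever mode is active.\<close>
  define K where "K = exp ((\<Sum>i\<in>UNIV. \<bar>lam i\<bar>) * T)"
  from U2 have T: "T > 0" and indep: "indep_vars (\<lambda>_. borel) H {1..}"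
    and distr: "\<And>i. i \<ge> 1 \<Longrightarrow> distr M borel (H i) = uniform_measure lborel {0..T}"
    and q: "\<And>i. q i \<ge> 0"
    and cond: "\<And>j i. j \<ge> 1 \<Longrightarrow> AE \<omega> in M. real_cond_exp M
           (vimage_algebra (space M) (\<lambda>\<omega>. \<lambda>k\<in>{..<j}. Y k \<omega>) (PiM {..<j} (\<lambda>_. count_space UNIV)))
           (indicator {\<omega> \<in> space M. Y j \<omega> = i}) \<omega> = q i"
    and HY: "indep_set
        (sets (vimage_algebra (space M) (\<lambda>\<omega>. \<lambda>i\<in>{1..}. H i \<omega>) (PiM {1..} (\<lambda>_. borel))))
        (sets (vimage_algebra (space M) (\<lambda>\<omega> i. Y i \<omega>) (PiM UNIV (\<lambda>_. count_space UNIV))))"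
    by (simp_all add: class_UH_def H_def Y_def)
  have H_meas[measurable]: "H (Suc k) \<in> borel_measurable M" for k using indep by (auto simp: indep_vars_def)
  have Y_seq: "(\<lambda>\<omega> i. Y i \<omega>) \<in> measurable M (PiM UNIV (\<lambda>_. count_space UNIV))"
    using indep_setD_ev2[OF HY] by (simp add: measurable_iff_sets space_PiM)
  have Y_meas[measurable]: "Y j \<in> measurable M (count_space UNIV)" for j
    using measurable_compose[OF Y_seq measurable_component_singleton[of j]] by simp
  have F_meas[measurable]: "F N \<in> borel_measurable M" for N unfolding F_def by measurable
  have sig: "AE \<omega> in M. \<sigma> 0 \<omega> = \<sigma>0 \<and> \<tau> 0 \<omega> = 0 \<and> (\<forall>i. \<tau> i \<omega> < \<tau> (Suc i) \<omega>) \<and>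
        (\<forall>i. \<forall>t\<in>{\<tau> i \<omega>..<\<tau> (Suc i) \<omega>}. \<sigma> t \<omega> = \<sigma> (\<tau> i \<omega>) \<omega>)"
    using assms(5) unfolding switching_signal_def by (auto elim!: eventually_mono)
  then have init: "AE \<omega> in M. Y 0 \<omega> = \<sigma>0"
    by eventually_elim (auto simp: Y_def mode_at_def)
  have g0: "g i \<ge> 0" for i using U1_mu by (simp add: g_def less_imp_le exp_ratio_pos)
  have \<rho>: "0 \<le> \<rho>" "\<rho> < 1"
    using U3 U1_mu q unfolding \<rho>_def by (auto intro!: sum_nonneg mult_nonneg_nonneg simp: less_imp_le exp_ratio_pos)
  have b0: "b N \<ge> 0" for N using g0 \<rho> by (simp add: b_def)
  \<comment> \<open>The shift drops the exceptional value \<open>b 0\<close> and leaves a geometric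
    series.\<close>
  have "summable (\<lambda>N. b (Suc N))" using \<rho> by (simp add: b_def summable_geometric summable_mult)
  then have bsum: "summable b" by (simp only: summable_Suc_iff)
  have F0: "F N \<omega> \<ge> 0" for N \<omega> using U1_mu by (auto simp: F_def intro!: prod_nonneg)
  have EF: "(\<integral>\<^sup>+\<omega>. ennreal (F N \<omega>) \<partial>M) \<le> ennreal (b N)" for N
  proof (cases N)
    case 0
    then show ?thesis by (simp add: F_def b_def emeasure_space_1)
  next
    case (Suc m)
    have "\<mu> \<ge> 0" using U1_mu by simp
    from nn_integral_prod_modulated_exp_le[OF T indep distr init cond q this HY, of lam m]
    show ?thesis by (simp only: Suc F_def b_def g_def \<rho>_def) simp
  qed
  have \<alpha>1_pos: "\<alpha>1 r \<ge> 0" if "r \<ge> 0" for r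
    using U1_K(1) that strict_mono_on_leD[of "{0..}" \<alpha>1 0 r] by (auto simp: class_K_inf_def class_K_def)
  have V0: "V i z \<ge> 0" for i z using U1_bounds[of z i] \<alpha>1_pos[of "norm z"] by simp
  have H_bounds: "AE \<omega> in M. \<forall>k. H (Suc k) \<omega> \<in> {0..T}"
    using AE_uniform_bounds[OF H_meas distr] by (simp add: AE_all_countable)
  \<comment> \<open>Excludes accumulation of the switching instants, so almost surely every time
    \<open>u \<ge> 0\<close> lies between two consecutive ones.\<close>
  have unbounded: "AE \<omega> in M. \<forall>t. \<exists>N. t < (\<Sum>k<N. H (Suc k) \<omega>)"
    by (rule AE_sum_uniform_unbounded[OF T indep distr])
  \<comment> \<open>\<open>N\<close> depends on \<open>\<omega>\<close>. The null set may depend on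
    \<open>x0\<close> and \<open>u\<close>, which is harmless because expectations are taken at
    fixed \<open>x0\<close> and \<open>u\<close>.\<close>
  have path: "AE \<omega> in M. \<exists>N\<ge>n. \<alpha>1 (norm (x x0 u \<omega>)) \<le> K * \<alpha>2 (norm x0) * F N \<omega>"
    if u: "u \<ge> real n * T" "u \<ge> 0" for n x0 u
  proof -
    have "AE \<omega> in M. caratheodory_solution f (\<lambda>t. \<sigma> t \<omega>) x0 (\<lambda>t. x x0 t \<omega>)"
      using assms(6) by (simp add: state_process_def)
    then show ?thesis using sig H_bounds unbounded
    proof eventually_elim
      case (elim \<omega>)
      define t where "t N = \<tau> N \<omega>" for N
      have t0: "t 0 = 0" and inc: "\<And>i. t i < t (Suc i)" using elim by (auto simp: t_def)
      have H_t: "H (Suc k) \<omega> = t (Suc k) - t k" for k by (simp add: H_def holding_time_def t_def)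
      have sum_H: "(\<Sum>k<N. H (Suc k) \<omega>) = t N" for N
        using sum_lessThan_telescope[of t N] by (simp add: H_t t0)
      have "\<exists>N. u < t N" using elim sum_H by metis
      with u t0 obtain N where N: "t N \<le> u" "u < t (Suc N)"
        by (metis unbounded_seq_interval)
      \<comment> \<open>Each holding time is at most \<open>T\<close>, so
        \<open>n * T \<le> u < t (Suc N) \<le> (N + 1) * T\<close> forces
        \<open>n \<le> N\<close>.\<close>
      have "t (Suc N) \<le> real (Suc N) * T"
        using sum_bounded_above[of "{..<Suc N}" "\<lambda>k. H (Suc k) \<omega>" T] elim by (simp only: sum_H) simp
      with N u have "real n * T < real (Suc N) * T" by linarith
      then have "n \<le> N" using T by simp
      let ?i = "\<sigma> (t N) \<omega>"
      have "\<mu> \<ge> 0" using U1_mu by simp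
      have FN: "F N \<omega> = (\<Prod>k<N. \<mu> * exp (- (lam (\<sigma> (t k) \<omega>) * (t (Suc k) - t k))))"
        by (simp add: F_def H_t Y_def mode_at_def t_def)
      have "\<alpha>1 (norm (x x0 u \<omega>)) \<le> V ?i (x x0 u \<omega>)" using U1_bounds by blast
      also have "\<dots> \<le> exp (- lam ?i * (u - t N)) * (F N \<omega> * V (\<sigma> (t 0) \<omega>) x0)"
        unfolding FN
        by (rule switched_Lyapunov_bound[where s = "\<lambda>t. \<sigma> t \<omega>", OF U1_C1 U1_decay \<open>\<mu> \<ge> 0\<close> U1_mu(2)])
           (use elim N t0 inc in \<open>auto simp: t_def\<close>)
      also have "\<dots> \<le> K * (F N \<omega> * \<alpha>2 (norm x0))"
      proof (intro mult_mono mult_nonneg_nonneg F0 V0)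
        have "- lam ?i * (u - t N) \<le> \<bar>lam ?i\<bar> * (u - t N)" using N by (intro mult_right_mono) auto
        also have "\<dots> \<le> (\<Sum>i\<in>UNIV. \<bar>lam i\<bar>) * T"
        proof (intro mult_mono)
          show "\<bar>lam ?i\<bar> \<le> (\<Sum>i\<in>UNIV. \<bar>lam i\<bar>)" by (rule member_le_sum) auto
          have "H (Suc N) \<omega> \<le> T" using elim by auto
          then show "u - t N \<le> T" using N H_t[of N] by linarith
        qed (use N in \<open>auto intro: sum_nonneg\<close>)
        finally show "exp (- lam ?i * (u - t N)) \<le> K" by (simp add: K_def)
      qed (use U1_bounds in \<open>auto simp: K_def\<close>)
      finally show ?case using \<open>n \<le> N\<close> by (auto simp: mult_ac)
    qed
  qed
  have bound: "(\<integral>\<^sup>+ \<omega>. ennreal (\<alpha>1 (norm (x x0 u \<omega>))) \<partial>M) \<le> ennreal (K * \<alpha>2 (norm x0) * (\<Sum>j. b (j + n)))"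
    if u: "u \<ge> real n * T" "u \<ge> 0" for n x0 u
  proof -
    define C where "C = K * \<alpha>2 (norm x0)"
    have "\<alpha>2 (norm x0) \<ge> 0" using U1_bounds[of x0] V0[of _ x0] order_trans by blast
    then have C: "C \<ge> 0" by (simp add: C_def K_def)
    \<comment> \<open>The index \<open>N\<close> in \<open>path\<close> is random; adding up all
      \<open>F (j + n)\<close> gives a dominating series free of it. An almost sure inequality is
      enough to compare the integrals, since monotonicity holds for nonmeasurable nonnegative
      integrands too.\<close>
    have "AE \<omega> in M. ennreal (\<alpha>1 (norm (x x0 u \<omega>))) \<le> ennreal C * (\<Sum>j. ennreal (F (j + n) \<omega>))"
      using path[OF u, of x0]
    proof eventually_elim
      case (elim \<omega>)
      then obtain N where N: "N \<ge> n" "\<alpha>1 (norm (x x0 u \<omega>)) \<le> C * F N \<omega>" by (auto simp: C_def)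
      have "ennreal (\<alpha>1 (norm (x x0 u \<omega>))) \<le> ennreal C * ennreal (F N \<omega>)"
        using N C F0 by (simp add: ennreal_leI flip: ennreal_mult)
      also have "ennreal (F N \<omega>) \<le> (\<Sum>j. ennreal (F (j + n) \<omega>))"
        using sum_le_suminf[of "\<lambda>j. ennreal (F (j + n) \<omega>)" "{N - n}"] N by simp
      finally show ?case by (simp add: mult_left_mono)
    qed
    then have "(\<integral>\<^sup>+ \<omega>. ennreal (\<alpha>1 (norm (x x0 u \<omega>))) \<partial>M)
        \<le> (\<integral>\<^sup>+ \<omega>. ennreal C * (\<Sum>j. ennreal (F (j + n) \<omega>)) \<partial>M)"
      by (rule nn_integral_mono_AE)
    also have "\<dots> = ennreal C * (\<Sum>j. \<integral>\<^sup>+ \<omega>. ennreal (F (j + n) \<omega>) \<partial>M)"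
      by (simp add: nn_integral_cmult nn_integral_suminf)
    also have "\<dots> \<le> ennreal C * (\<Sum>j. ennreal (b (j + n)))"
      by (intro mult_left_mono suminf_le EF) auto
    also have "\<dots> = ennreal C * ennreal (\<Sum>j. b (j + n))"
      by (subst suminf_ennreal2) (auto intro: b0 summable_ignore_initial_segment bsum)
    also have "\<dots> = ennreal (C * (\<Sum>j. b (j + n)))"
      using C by (intro ennreal_mult[symmetric] suminf_nonneg summable_ignore_initial_segment bsum b0)
    finally show ?thesis by (simp add: C_def)
  qed
  show ?thesis
  proof (rule gas_in_meanI)
    show "class_K \<alpha>2" using U1_K(2) by (simp add: class_K_inf_def)
    show "summable b" "\<And>N. b N \<ge> 0" by fact+
    show "K \<ge> 0" "T \<ge> 0" using T by (simp_all add: K_def)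
    show "(\<integral>\<^sup>+ \<omega>. ennreal (\<alpha>1 (norm (x x0 u \<omega>))) \<partial>M) \<le> ennreal (K * \<alpha>2 (norm x0) * (\<Sum>j. b (j + n)))"
      if "u \<ge> real n * T" "u \<ge> 0" for n x0 u
      using that by (rule bound)
  qed
qed

end
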